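(* Let $A$ be a unital $C^*$-algebra, and let $T(A)$ be the set of all tracial states on $A$, equipped with the weak$^*$ topology. Then the compact convex set $T(A)$ is a (possibly empty) Choquet simplex.
   Context: A tracial state on a unital $C^*$-algebra $A$ is a positive linear functional $\tau\colon A\to\mathbb{C}$ with $\tau(1)=1$ and $\tau(ab)=\tau(ba)$ for all $a,b\in A$. The state space $S(A)$ is compact and convex in the weak$^*$ topology of $A^*$, and $T(A)$ is a closed convex subset of $S(A)$. Choquet simplex: let $K$ be a compact convex subset of a locally convex topological vector space. A (Borel) probability measure $\mu$ on $K$ is a boundary measure if it is maximal in the sense that whenever $\nu$ is a probability measure on $K$ with $\mu(f)\le\nu(f)$ for all continuous convex functions $f\colon K\to\mathbb{R}$, then $\nu=\mu$. The barycenter of $\mu$ is $\int_K x\,d\mu(x)\in K$. $K$ is a Choquet simplex if it satisfies the following conditions, which are classically known to be equivalent: (1) each point of $K$ is the barycenter of a unique boundary measure on $K$; (2) the ordered vector space $\mathrm{Aff}(K)^*$ is a lattice, where $\mathrm{Aff}(K)$ is the space of continuous affine functions $K\to\mathbb{R}$ with the pointwise order, and $\mathrm{Aff}(K)^*$ carries the dual order; (3) (Riesz decomposition property) whenever $x=\sum_{j=1}^n\alpha_jx_j=\sum_{i=1}^m\beta_iy_i$ with $x_j,y_i\in K$, $\alpha_j,\beta_i>0$ and $\sum_j\alpha_j=\sum_i\beta_i=1$, there exist $z_{ij}\in K$ and $\gamma_{ij}\ge 0$ ($1\le j\le n$, $1\le i\le m$) with $\sum_{i,j}\gamma_{ij}=1$,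 $x=\sum_{i,j}\gamma_{ij}z_{ij}$, and $\alpha_j=\sum_{i=1}^m\gamma_{ij}$, $\beta_i=\sum_{j=1}^n\gamma_{ij}$, $x_j=\sum_{i=1}^m\alpha_j^{-1}\gamma_{ij}z_{ij}$, $y_i=\sum_{j=1}^n\beta_i^{-1}\gamma_{ij}z_{ij}$ for all $i,j$. The empty set is regarded as a Choquet simplex. *)

theory Defs
  imports "HOL-Analysis.Analysis"
begin

(* The library class real_normed_algebra_1 is avoided because it demands 0 \<noteq> 1;
   here the zero algebra is allowed, and norm 1 = 1 for nonzero algebras follows from
   the C*-identity. *)
class unital_cstar_algebra = real_normed_algebra + banach + monoid_mult +
  fixes scaleC :: "complex \<Rightarrow> 'a \<Rightarrow> 'a" (infixr "*\<^sub>C" 75)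
    and adj :: "'a \<Rightarrow> 'a"
  assumes scaleC_add_right: "c *\<^sub>C (x + y) = c *\<^sub>C x + c *\<^sub>C y"
    and scaleC_add_left: "(c + d) *\<^sub>C x = c *\<^sub>C x + d *\<^sub>C x"
    and scaleC_scaleC: "c *\<^sub>C d *\<^sub>C x = (c * d) *\<^sub>C x"
    and scaleR_scaleC: "r *\<^sub>R x = complex_of_real r *\<^sub>C x"
    and mult_scaleC_left: "(c *\<^sub>C x) * y = c *\<^sub>C (x * y)"
    and mult_scaleC_right: "x * (c *\<^sub>C y) = c *\<^sub>C (x * y)"
    and norm_scaleC: "norm (c *\<^sub>C x) = cmod c * norm x"
    and adj_add: "adj (x + y) = adj x + adj y"
    and adj_scaleC: "adj (c *\<^sub>C x) = cnj c *\<^sub>C adj x"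
    and adj_mult: "adj (x * y) = adj y * adj x"
    and adj_adj: "adj (adj x) = x"
    and cstar_identity: "norm (adj x * x) = (norm x)\<^sup>2"

definition tracial_state :: "('a::unital_cstar_algebra \<Rightarrow> complex) \<Rightarrow> bool" where
  "tracial_state \<tau> \<longleftrightarrow>
     Vector_Spaces.linear (*\<^sub>C) (*) \<tau> \<and>
     (\<forall>a. \<tau> (adj a * a) \<in> \<real>\<^sub>\<ge>\<^sub>0) \<and>
     \<tau> 1 = 1 \<and>
     (\<forall>a b. \<tau> (a * b) = \<tau> (b * a))"

(* The Banach dual A^* : the real-linear bounded maps that are complex linear. *)
definition dual_space :: "('a::unital_cstar_algebra \<Rightarrow>\<^sub>L complex) set" where
  "dual_space = {\<phi>. Vector_Spaces.linear (*\<^sub>C) (*) (blinfun_apply \<phi>)}"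

(* The coarsest topology on A^* making all evaluations at points of A continuous. *)
definition weak_star_topology :: "('a::unital_cstar_algebra \<Rightarrow>\<^sub>L complex) topology" where
  "weak_star_topology =
     pullback_topology dual_space blinfun_apply (product_topology (\<lambda>_. euclidean) UNIV)"

(* Positive functionals are automatically bounded, so taking the traces inside A^*
   loses none of them. *)
definition tracial_states :: "('a::unital_cstar_algebra \<Rightarrow>\<^sub>L complex) set" where
  "tracial_states = {\<tau> \<in> dual_space. tracial_state (blinfun_apply \<tau>)}"

(* The space is the linear subspace topspace T of the ambient type. *)
definition locally_convex_space :: "'v::real_vector topology \<Rightarrow> bool" where
  "locally_convex_space T \<longleftrightarrow>
     subspace (topspace T) \<and>
     Hausdorff_space T \<and>
     continuous_map (prod_topology T T) T (\<lambda>(x, y). x + y) \<and>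
     continuous_map (prod_topology euclideanreal T) T (\<lambda>(c, x). c *\<^sub>R x) \<and>
     (\<forall>U. openin T U \<and> 0 \<in> U \<longrightarrow> (\<exists>V. openin T V \<and> convex V \<and> 0 \<in> V \<and> V \<subseteq> U))"

definition riesz_decomposition_property :: "'v::real_vector set \<Rightarrow> bool" where
  "riesz_decomposition_property K \<longleftrightarrow>
     (\<forall>(n::nat) (m::nat) (\<alpha> :: nat \<Rightarrow> real) (\<beta> :: nat \<Rightarrow> real) (x :: nat \<Rightarrow> 'v) (y :: nat \<Rightarrow> 'v) (p :: 'v).
        (\<forall>j\<in>{1..n}. x j \<in> K \<and> \<alpha> j > 0) \<and>
        (\<forall>i\<in>{1..m}. y i \<in> K \<and> \<beta> i > 0) \<and>
        (\<Sum>j=1..n. \<alpha> j) = 1 \<and> (\<Sum>i=1..m. \<beta> i) = 1 \<and>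
        p = (\<Sum>j=1..n. \<alpha> j *\<^sub>R x j) \<and> p = (\<Sum>i=1..m. \<beta> i *\<^sub>R y i)
        \<longrightarrow>
        (\<exists>(z :: nat \<Rightarrow> nat \<Rightarrow> 'v) (\<gamma> :: nat \<Rightarrow> nat \<Rightarrow> real).
           (\<forall>i\<in>{1..m}. \<forall>j\<in>{1..n}. z i j \<in> K \<and> \<gamma> i j \<ge> 0) \<and>
           (\<Sum>i=1..m. \<Sum>j=1..n. \<gamma> i j) = 1 \<and>
           p = (\<Sum>i=1..m. \<Sum>j=1..n. \<gamma> i j *\<^sub>R z i j) \<and>
           (\<forall>j\<in>{1..n}. \<alpha> j = (\<Sum>i=1..m. \<gamma> i j)) \<and>
           (\<forall>i\<in>{1..m}. \<beta> i = (\<Sum>j=1..n. \<gamma> i j)) \<and>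
           (\<forall>j\<in>{1..n}. x j = (\<Sum>i=1..m. (inverse (\<alpha> j) * \<gamma> i j) *\<^sub>R z i j)) \<and>
           (\<forall>i\<in>{1..m}. y i = (\<Sum>j=1..n. (inverse (\<beta> i) * \<gamma> i j) *\<^sub>R z i j))))"

(* Of the classical equivalent definitions of a Choquet simplex (unique representing
   boundary measures, lattice order on Aff(K)^*, Riesz decomposition) the last is used.
   The empty set qualifies. *)
definition choquet_simplex :: "'v::real_vector topology \<Rightarrow> 'v set \<Rightarrow> bool" where
  "choquet_simplex T K \<longleftrightarrow>
     locally_convex_space T \<and> compactin T K \<and> convex K \<and> riesz_decomposition_property K"

end

(*
  Given p = sum_j alpha_j x_j = sum_i beta_i y_i in T(A), each alpha_j x_j and each beta_i y_i is a
  positive tracial functional dominated by p.  In the GNS space L^2(A, p) such functionals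
  correspond to positive contractions commuting with the left and right actions of A; these
  operators commute with each other, and the functionals of the products h_j k_i give the common
  refinement.  The completion is never formed: an operator h is represented by self-adjoint
  elements c_n of A approximating its functional in the 2-norm, and the functional of h k is
  lim phi(c_n d).  Positivity of h k follows from the Riesz--Nagy expansion h = sum_n h_n^2,
  where h_0 = h and h_{n+1} = h_n - h_n^2, since h_n^2 k = h_n k h_n >= 0.  Compactness is
  Banach--Alaoglu.
*)
theory Submission imports Defs begin

section \<open>Positive functionals\<close>

text \<open>Nothing bounds the operator norms of the approximants \<open>apx \<phi> n\<close>; they
  are controlled only in the 2-norm \<open>N\<close>. This shapes the limit estimates: one
  approximant is traded for an error \<open>err n\<close>, at most one other is measured by
  \<open>N\<close>, and the remaining factors are measured by \<open>norm\<close>. Longer products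
  of operators are therefore reached by successive limits of functionals, not by multiplying
  approximants. The trace makes this work: \<open>N\<close> is invariant under \<open>adj\<close>,
  so left and right multiplication are both bounded for \<open>N\<close>, and approximants can be
  moved cyclically. The approximants are self-adjoint so that \<psi>(c d c), which approaches the
  functional of h^2 k, is visibly positive for d = \<open>adj a * a\<close>. The Riesz-Nagy
  expansion replaces a square root of h because it needs only squares, differences and limits of
  dominated functionals, with no functional calculus.\<close>

lemma scaleC_one [simp]: "1 *\<^sub>C (x :: 'a::unital_cstar_algebra) = x"
  by (metis of_real_1 scaleR_one scaleR_scaleC)

lemma vector_space_scaleC: "vector_space ((*\<^sub>C) :: complex \<Rightarrow> 'a::unital_cstar_algebra \<Rightarrow> 'a)"
  by unfold_locales (simp_all add: scaleC_add_right scaleC_add_left scaleC_scaleC)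

lemma vector_space_complex: "vector_space ((*) :: complex \<Rightarrow> complex \<Rightarrow> complex)"
  by unfold_locales (simp_all add: algebra_simps)

lemma linear_scaleC_iff:
  "Vector_Spaces.linear (*\<^sub>C) (*) (f :: 'a::unital_cstar_algebra \<Rightarrow> complex) \<longleftrightarrow>
     (\<forall>x y. f (x + y) = f x + f y) \<and> (\<forall>c x. f (c *\<^sub>C x) = c * f x)"
  using vector_space_scaleC[where ?'a='a] vector_space_complex
  by (simp add: Vector_Spaces.linear_iff)

lemma scaleC_zero_left [simp]: "0 *\<^sub>C (x :: 'a::unital_cstar_algebra) = 0"
  by (metis of_real_0 scaleR_zero_left scaleR_scaleC)

lemma scaleC_minus_one: "(- 1) *\<^sub>C (x :: 'a::unital_cstar_algebra) = - x"
  by (metis of_real_1 of_real_minus scaleR_minus1_left scaleR_scaleC)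

lemma adj_zero [simp]: "adj (0 :: 'a::unital_cstar_algebra) = 0"
  using adj_add[of 0 "0 :: 'a"] by simp

lemma adj_minus: "adj (- x :: 'a::unital_cstar_algebra) = - adj x"
  using adj_add[of x "- x"] by (simp add: eq_neg_iff_add_eq_0 add.commute)

lemma adj_diff: "adj (x - y :: 'a::unital_cstar_algebra) = adj x - adj y"
  using adj_add[of x "- y"] by (simp add: adj_minus)

lemma adj_scaleR: "adj (r *\<^sub>R x :: 'a::unital_cstar_algebra) = r *\<^sub>R adj x"
  by (simp add: scaleR_scaleC adj_scaleC)

lemma adj_one [simp]: "adj (1 :: 'a::unital_cstar_algebra) = 1"
  by (metis adj_adj adj_mult mult_1_left mult_1_right)

text \<open>The C*-identity and submultiplicativity bound the square of the norm of b by the product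
  of the norms of b and \<open>adj b\<close>; one factor cancels, and b may be replaced by its
  adjoint.\<close>

lemma norm_adj [simp]: "norm (adj a :: 'a::unital_cstar_algebra) = norm a"
proof -
  have le: "norm b \<le> norm (adj b)" for b :: 'a
  proof (cases "b = 0")
    case False
    have "norm b * norm b \<le> norm (adj b) * norm b"
      using cstar_identity[of b] norm_mult_ineq[of "adj b" b] by (simp add: power2_eq_square)
    then show ?thesis using False by simp
  qed simp
  from le[of a] le[of "adj a"] show ?thesis by (simp add: adj_adj)
qed

text \<open>Restricting c to real multiples of \<open>cnj z\<close> leaves a real quadratic in t.
  This gives both Cauchy-Schwarz and the error bound for the almost-minimiser in
  \<open>approx_represent\<close>.\<close>

lemma complex_quadratic_discriminant:
  fixes z :: complex and A B :: real
  assumes q: "\<And>c. 0 \<le> A + 2 * Re (c * z) + (cmod c)\<^sup>2 * B" and B0: "0 \<le> B"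
  shows "(cmod z)\<^sup>2 \<le> A * B"
proof -
  have pos_t: "0 \<le> A - 2 * t * (cmod z)\<^sup>2 + t\<^sup>2 * (cmod z)\<^sup>2 * B" for t :: real
  proof -
    have "of_real (- t) * cnj z * z = of_real (- t * (cmod z)\<^sup>2)"
      using complex_norm_square[of z] by (simp add: mult_ac)
    then have 1: "Re (of_real (- t) * cnj z * z) = - t * (cmod z)\<^sup>2"
      by (simp only: Re_complex_of_real)
    have 2: "(cmod (of_real (- t) * cnj z))\<^sup>2 = t\<^sup>2 * (cmod z)\<^sup>2"
      by (simp add: norm_mult power_mult_distrib)
    show ?thesis using q[of "of_real (- t) * cnj z"] unfolding 1 2 by simp
  qed
  show ?thesis
  proof (cases "B = 0")
    case True
    show ?thesis
    proof (rule ccontr)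
      assume "\<not> ?thesis"
      then have zp: "(cmod z)\<^sup>2 > 0" using True by simp
      \<comment> \<open>With B = 0 the quadratic is linear in t, and this t brings it down to
        -1.\<close>
      have "0 \<le> A - 2 * ((A + 1) / (2 * (cmod z)\<^sup>2)) * (cmod z)\<^sup>2"
        using pos_t[of "(A + 1) / (2 * (cmod z)\<^sup>2)"] True by simp
      also have "\<dots> = - 1" using zp by (simp add: field_simps)
      finally show False by simp
    qed
  next
    case False
    then have B: "B > 0" using B0 by simp
    \<comment> \<open>t = 1/B minimises the quadratic.\<close>
    have "0 \<le> A - (cmod z)\<^sup>2 / B"
      using pos_t[of "1 / B"] B by (simp add: power2_eq_square field_simps)
    then show ?thesis using B by (simp add: field_simps)
  qed
qed

locale clinear_functional =
  fixes f :: "'a::unital_cstar_algebra \<Rightarrow> complex"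
  assumes linear: "Vector_Spaces.linear (*\<^sub>C) (*) f"
begin

lemma add: "f (x + y) = f x + f y"
  and scaleC: "f (c *\<^sub>C x) = c * f x"
  using linear by (simp_all add: linear_scaleC_iff)

lemma zero [simp]: "f 0 = 0"
  using scaleC[of 0 0] by simp

lemma minus: "f (- x) = - f x"
  using scaleC[of "- 1" x] by (simp add: scaleC_minus_one)

lemma diff: "f (x - y) = f x - f y"
  using add[of x "- y"] by (simp add: minus)

lemma scaleR: "f (r *\<^sub>R x) = r *\<^sub>R f x"
  by (simp add: scaleR_scaleC scaleC scaleR_conv_of_real)

end

text \<open>The bound has an unspecified constant; \<open>norm_le\<close> later sharpens it to
  \<open>Re (f 1)\<close> using only Cauchy-Schwarz and the C*-identity.\<close>

locale positive_functional = clinear_functional f for f :: "'a::unital_cstar_algebra \<Rightarrow> complex" +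
  assumes pos: "f (adj a * a) \<in> \<real>\<^sub>\<ge>\<^sub>0"
    and bounded: "\<exists>C. \<forall>a. cmod (f a) \<le> C * norm a"
begin

lemma Re_pos: "0 \<le> Re (f (adj a * a))" and Im_pos: "Im (f (adj a * a)) = 0"
  using pos[of a] by (simp_all add: complex_nonneg_Reals_iff)

lemma eq_Re: "f (adj a * a) = of_real (Re (f (adj a * a)))"
  by (simp add: complex_eq_iff Im_pos)

lemma expand:
  "f (adj (a + c *\<^sub>C b) * (a + c *\<^sub>C b)) =
     f (adj a * a) + c * f (adj a * b) + cnj c * f (adj b * a) + cnj c * c * f (adj b * b)"
  by (simp add: adj_add adj_scaleC distrib_left distrib_right mult_scaleC_left mult_scaleC_right
      scaleC_scaleC add scaleC)

text \<open>Polarisation: c = 1 and c = i in \<open>expand\<close>, where all imaginary parts on the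
  diagonal vanish, settle the imaginary and the real part.\<close>

lemma hermitian: "f (adj b * a) = cnj (f (adj a * b))"
proof -
  have 1: "Im (f (adj a * b) + f (adj b * a)) = 0"
    using Im_pos[of "a + 1 *\<^sub>C b"] unfolding expand by (simp add: Im_pos)
  have 2: "Re (f (adj a * b)) - Re (f (adj b * a)) = 0"
    using Im_pos[of "a + \<i> *\<^sub>C b"] unfolding expand by (simp add: Im_pos)
  show ?thesis using 1 2 by (simp add: complex_eq_iff)
qed

lemma adj: "f (adj a) = cnj (f a)"
  using hermitian[of a 1] by simp

lemma cauchy_schwarz:
  "(cmod (f (adj a * b)))\<^sup>2 \<le> Re (f (adj a * a)) * Re (f (adj b * b))"
proof (rule complex_quadratic_discriminant)
  show "0 \<le> Re (f (adj a * a)) + 2 * Re (c * f (adj a * b)) + (cmod c)\<^sup>2 * Re (f (adj b * b))" for c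
  proof -
    have "Re (f (adj (a + c *\<^sub>C b) * (a + c *\<^sub>C b))) = Re (f (adj a * a)) +
        Re (c * f (adj a * b)) + Re (cnj c * cnj (f (adj a * b))) + Re (cnj c * c * f (adj b * b))"
      unfolding expand hermitian[of b a] by simp
    also have "Re (cnj c * cnj (f (adj a * b))) = Re (c * f (adj a * b))" by simp
    also have "Re (cnj c * c * f (adj b * b)) = (cmod c)\<^sup>2 * Re (f (adj b * b))"
      by (subst eq_Re) (simp add: cmod_power2 flip: power2_eq_square)
    finally show ?thesis using Re_pos[of "a + c *\<^sub>C b"] by simp
  qed
qed (rule Re_pos)

lemma cauchy_schwarz':
  "cmod (f (adj a * b)) \<le> sqrt (Re (f (adj a * a))) * sqrt (Re (f (adj b * b)))"
  using real_le_rsqrt[OF cauchy_schwarz[of a b]] by (simp add: real_sqrt_mult)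

text \<open>The supremum \<open>S\<close> of the left-hand side over the unit ball satisfies \<open>S\<^sup>2 \<le> f(1) S\<close>.\<close>
lemma Re_le_norm: "Re (f (adj b * b)) \<le> Re (f 1) * (norm b)\<^sup>2"
proof -
  obtain C where C: "\<And>a. cmod (f a) \<le> C * norm a" using bounded by blast
  define V where "V = (\<lambda>b. Re (f (adj b * b))) ` {b. norm b \<le> 1}"
  have F1: "0 \<le> Re (f 1)" using Re_pos[of 1] by simp
  have bdd: "bdd_above V"
  proof (rule bdd_aboveI)
    fix v assume "v \<in> V"
    then obtain b where b: "norm b \<le> 1" "v = Re (f (adj b * b))" by (auto simp: V_def)
    have "v \<le> cmod (f (adj b * b))" using b complex_Re_le_cmod by simp
    also have "\<dots> \<le> C * norm (adj b * b)" by (rule C)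
    also have "\<dots> \<le> \<bar>C\<bar> * norm (adj b * b)" by (simp add: mult_right_mono)
    also have "\<dots> \<le> \<bar>C\<bar> * 1"
      using b by (intro mult_left_mono) (simp_all add: cstar_identity power_le_one)
    finally show "v \<le> \<bar>C\<bar> * 1" .
  qed
  have up: "Re (f (adj b * b)) \<le> Sup V" if "norm b \<le> 1" for b
    using that bdd by (intro cSup_upper) (auto simp: V_def)
  have S0: "0 \<le> Sup V" using up[of 0] by simp
  \<comment> \<open>Cauchy-Schwarz pairs 1 with \<open>adj b * b\<close>, which by the C*-identity
    lies in the unit ball again, so the supremum reappears on the right.\<close>
  have sq: "Re (f (adj b * b)) \<le> sqrt (Re (f 1) * Sup V)" if b: "norm b \<le> 1" for b
  proof -
    have "(Re (f (adj b * b)))\<^sup>2 \<le> (cmod (f (adj 1 * (adj b * b))))\<^sup>2"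
      by (simp add: cmod_power2)
    also have "\<dots> \<le> Re (f (adj 1 * 1)) * Re (f (adj (adj b * b) * (adj b * b)))"
      by (rule cauchy_schwarz)
    also have "\<dots> \<le> Re (f 1) * Sup V"
    proof -
      have "norm (adj b * b) \<le> 1" using b by (simp add: cstar_identity power_le_one)
      then have "Re (f (adj (adj b * b) * (adj b * b))) \<le> Sup V" by (rule up)
      then show ?thesis using F1 by (simp add: mult_left_mono)
    qed
    finally show ?thesis by (rule real_le_rsqrt)
  qed
  have "Sup V \<le> sqrt (Re (f 1) * Sup V)"
  proof (rule cSup_least)
    have "0 \<in> {b :: 'a. norm b \<le> 1}" by simp
    then show "V \<noteq> {}" unfolding V_def by blast
    show "v \<le> sqrt (Re (f 1) * Sup V)" if v: "v \<in> V" for v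
    proof -
      obtain b where "norm b \<le> 1" "v = Re (f (adj b * b))"
        using v unfolding V_def by blast
      then show ?thesis using sq by blast
    qed
  qed
  then have "(Sup V)\<^sup>2 \<le> Re (f 1) * Sup V"
    using power_mono[of "Sup V" "sqrt (Re (f 1) * Sup V)" 2] S0 F1 by simp
  then have S: "Sup V \<le> Re (f 1)"
    using S0 F1 by (cases "Sup V = 0") (simp_all add: power2_eq_square)
  show ?thesis
  proof (cases "b = 0")
    case False
    define r where "r = inverse (norm b)"
    have r: "r * norm b = 1" "norm (r *\<^sub>R b) \<le> 1" using False by (simp_all add: r_def)
    have "r\<^sup>2 * Re (f (adj b * b)) = Re (f (adj (r *\<^sub>R b) * (r *\<^sub>R b)))"
      by (simp add: adj_scaleR scaleR power2_eq_square)
    also have "\<dots> \<le> Re (f 1)" using up[OF r(2)] S by linarith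
    finally have "(norm b)\<^sup>2 * (r\<^sup>2 * Re (f (adj b * b))) \<le> (norm b)\<^sup>2 * Re (f 1)"
      by (simp add: mult_left_mono)
    moreover have "(norm b)\<^sup>2 * (r\<^sup>2 * Re (f (adj b * b))) = (r * norm b)\<^sup>2 * Re (f (adj b * b))"
      by (simp add: power_mult_distrib mult_ac)
    ultimately show ?thesis by (simp add: r(1) mult.commute)
  qed simp
qed

lemma norm_le: "cmod (f a) \<le> Re (f 1) * norm a"
proof -
  have F1: "0 \<le> Re (f 1)" using Re_pos[of 1] by simp
  have "(cmod (f (adj 1 * a)))\<^sup>2 \<le> Re (f (adj 1 * 1)) * Re (f (adj a * a))"
    by (rule cauchy_schwarz)
  also have "\<dots> \<le> Re (f 1) * (Re (f 1) * (norm a)\<^sup>2)"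
    using mult_left_mono[OF Re_le_norm F1] by simp
  finally have "(cmod (f a))\<^sup>2 \<le> (Re (f 1) * norm a)\<^sup>2"
    by (simp add: power_mult_distrib) (simp add: power2_eq_square)
  then show ?thesis by (rule power2_le_imp_le) (use F1 in simp)
qed

end

section \<open>The 2-norm of a trace\<close>

locale tracial_functional = positive_functional f for f :: "'a::unital_cstar_algebra \<Rightarrow> complex" +
  assumes trace: "f (a * b) = f (b * a)"

section \<open>Limits with an explicit rate\<close>

text \<open>The shift by one keeps the error positive and at most 1 from n = 0 on; the bound 2 in
  \<open>N_apx_le\<close> relies on this.\<close>

abbreviation (input) err :: "nat \<Rightarrow> real" where "err n \<equiv> inverse (real (Suc n))"

lemma err_bounds: "0 < err n" "err n \<le> 1"
  by (simp_all add: divide_simps)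

lemma tendsto_of_err_bound:
  fixes X Y :: "nat \<Rightarrow> complex"
  assumes "\<And>n. cmod (X n - Y n) \<le> K * err n" and "Y \<longlonglongrightarrow> L"
  shows "X \<longlonglongrightarrow> L"
proof -
  have "(\<lambda>n. K * err n) \<longlonglongrightarrow> K * 0"
    by (intro tendsto_intros LIMSEQ_inverse_real_of_nat)
  then have "(\<lambda>n. X n - Y n) \<longlonglongrightarrow> 0"
    using Lim_null_comparison[OF always_eventually[OF allI[OF assms(1)]]] by simp
  from tendsto_add[OF this assms(2)] show ?thesis by simp
qed

text \<open>The rate survives because k can tend to infinity with n fixed, leaving only the
  \<open>err n\<close> term.\<close>

lemma convergent_of_err_bound:
  fixes X :: "nat \<Rightarrow> complex"
  assumes X: "\<And>n k. cmod (X n - X k) \<le> K * (err n + err k)"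
  shows "X \<longlonglongrightarrow> lim X" and "cmod (X n - lim X) \<le> K * err n"
proof -
  have K: "0 \<le> K" using order_trans[OF norm_ge_zero X[of 0 0]] by simp
  have "Cauchy X"
  proof (rule CauchyI)
    fix e :: real assume e: "0 < e"
    have "(\<lambda>n. (2 * K) * err n) \<longlonglongrightarrow> (2 * K) * 0"
      by (intro tendsto_intros LIMSEQ_inverse_real_of_nat)
    then have "\<forall>\<^sub>F n in sequentially. (2 * K) * err n < e" using e by (intro order_tendstoD) auto
    then obtain M where M: "(2 * K) * err M < e" by (auto simp: eventually_sequentially)
    have "cmod (X m - X n) < e" if "m \<ge> M" "n \<ge> M" for m n
    proof -
      have "cmod (X m - X n) \<le> K * (err m + err n)" by (rule X)
      also have "\<dots> \<le> K * (err M + err M)"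
        using that K by (intro mult_left_mono add_mono le_imp_inverse_le) auto
      also have "\<dots> < e" using M by simp
      finally show ?thesis .
    qed
    then show "\<exists>M. \<forall>m\<ge>M. \<forall>n\<ge>M. cmod (X m - X n) < e" by blast
  qed
  then show lim: "X \<longlonglongrightarrow> lim X" by (simp add: Cauchy_convergent_iff convergent_LIMSEQ_iff)
  have "(\<lambda>k. cmod (X n - X k)) \<longlonglongrightarrow> cmod (X n - lim X)" by (intro tendsto_intros lim)
  moreover have "(\<lambda>k. K * (err n + err k)) \<longlonglongrightarrow> K * (err n + 0)"
    by (intro tendsto_intros LIMSEQ_inverse_real_of_nat)
  ultimately show "cmod (X n - lim X) \<le> K * err n"
    using X by (auto intro: LIMSEQ_le)
qed

locale normalized_trace = tracial_functional \<tau> for \<tau> :: "'a::unital_cstar_algebra \<Rightarrow> complex" +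
  assumes one: "\<tau> 1 = 1"
begin

text \<open>The GNS seminorm. It may vanish on nonzero elements, since no quotient is taken; hence
  the separate case of value 0 wherever a factor \<open>N d\<close> is cancelled.\<close>

definition N :: "'a \<Rightarrow> real" where "N a = sqrt (Re (\<tau> (adj a * a)))"

lemma N_nonneg: "0 \<le> N a" by (simp add: N_def Re_pos)

lemma N_square: "(N a)\<^sup>2 = Re (\<tau> (adj a * a))" by (simp add: N_def Re_pos)

lemma tau_eq_N: "\<tau> (adj a * a) = of_real ((N a)\<^sup>2)"
  unfolding N_square by (rule eq_Re)

lemma N_adj: "N (adj a) = N a"
  by (simp add: N_def adj_adj trace[of a "adj a"])

lemma N_one: "N 1 = 1" by (simp add: N_def one)

text \<open>Conjugation by y turns \<tau> into a positive functional with value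
  \<open>(N y)\<^sup>2\<close> at 1, and \<open>Re_le_norm\<close> applies to it.\<close>

lemma N_mult_le_right: "N (x * y) \<le> norm x * N y"
proof -
  interpret g: positive_functional "\<lambda>b. \<tau> (adj y * b * y)"
  proof (intro positive_functional.intro clinear_functional.intro positive_functional_axioms.intro)
    show "Vector_Spaces.linear (*\<^sub>C) (*) (\<lambda>b. \<tau> (adj y * b * y))"
      by (simp add: linear_scaleC_iff distrib_left distrib_right add mult_scaleC_left
          mult_scaleC_right scaleC)
    show "\<tau> (adj y * (adj a * a) * y) \<in> \<real>\<^sub>\<ge>\<^sub>0" for a
      using pos[of "a * y"] by (simp add: adj_mult mult.assoc)
    have "cmod (\<tau> (adj y * a * y)) \<le> (norm y)\<^sup>2 * norm a" for a
    proof -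
      have "cmod (\<tau> (adj y * a * y)) \<le> norm (adj y * a * y)"
        using norm_le[of "adj y * a * y"] by (simp add: one)
      also have "\<dots> \<le> norm (adj y) * norm a * norm y"
        by (intro order_trans[OF norm_mult_ineq] mult_right_mono norm_mult_ineq) simp
      finally show ?thesis by (simp add: power2_eq_square mult_ac)
    qed
    then show "\<exists>C. \<forall>a. cmod (\<tau> (adj y * a * y)) \<le> C * norm a" by blast
  qed
  have "(N (x * y))\<^sup>2 \<le> (norm x * N y)\<^sup>2"
    using g.Re_le_norm[of x]
    by (simp add: N_square power_mult_distrib adj_mult mult.assoc mult.commute[of "(norm x)\<^sup>2"])
  then show ?thesis by (rule power2_le_imp_le) (simp add: N_nonneg)
qed

text \<open>This side depends on traciality, which enters through \<open>N_adj\<close>.\<close>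

lemma N_mult_le_left: "N (x * y) \<le> N x * norm y"
  using N_mult_le_right[of "adj y" "adj x"]
  by (simp add: N_adj mult.commute[of "norm y"] flip: adj_mult)

lemma N_le_norm: "N x \<le> norm x"
  using N_mult_le_right[of x 1] by (simp add: N_one)

lemma N_mult_mult_le: "N (x * c * y) \<le> norm x * N c * norm y"
  using N_mult_le_left[of "x * c" y] mult_right_mono[OF N_mult_le_right[of x c], of "norm y"]
  by simp

section \<open>Traces dominated by \<tau>\<close>

text \<open>The operator counterpart is 0 \<le> h \<le> 1, with h commuting with both actions of the
  algebra.\<close>

definition below :: "('a \<Rightarrow> complex) \<Rightarrow> bool" where
  "below \<phi> \<longleftrightarrow> tracial_functional \<phi> \<and> (\<forall>a. Re (\<phi> (adj a * a)) \<le> Re (\<tau> (adj a * a)))"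

lemma below_self: "below \<tau>"
  by (simp add: below_def tracial_functional_axioms)

lemma below_mult_le:
  assumes "below \<phi>" shows "cmod (\<phi> (a * b)) \<le> N a * N b"
proof -
  interpret \<phi>: tracial_functional \<phi> using assms by (simp add: below_def)
  have le: "sqrt (Re (\<phi> (adj c * c))) \<le> N c" for c
    using assms by (simp add: below_def N_def)
  have "cmod (\<phi> (adj (adj a) * b))
      \<le> sqrt (Re (\<phi> (adj (adj a) * adj a))) * sqrt (Re (\<phi> (adj b * b)))"
    by (rule \<phi>.cauchy_schwarz')
  also have "\<dots> \<le> N (adj a) * N b"
    by (intro mult_mono le) (simp_all add: N_nonneg \<phi>.Re_pos)
  finally show ?thesis by (simp add: adj_adj N_adj)
qed

lemma below_le: "below \<phi> \<Longrightarrow> cmod (\<phi> a) \<le> N a"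
  using below_mult_le[of \<phi> 1 a] by (simp add: N_one)

text \<open>Riesz representation without completing: an almost-minimiser of
  \<open>\<parallel>b\<parallel>\<^sup>2 - 2 Re \<phi>(b)\<close> represents \<open>\<phi>\<close> up to a small error in the 2-norm.\<close>
lemma approx_represent:
  assumes \<phi>: "below \<phi>" and e: "0 < e"
  shows "\<exists>c. adj c = c \<and> (\<forall>a. cmod (\<phi> a - \<tau> (c * a)) \<le> e * N a)"
proof -
  interpret \<phi>: tracial_functional \<phi> using \<phi> by (simp add: below_def)
  define F where "F b = (N b)\<^sup>2 - 2 * Re (\<phi> b)" for b
  have "bdd_below (range F)"
  proof (rule bdd_belowI)
    fix v assume "v \<in> range F"
    then obtain b where v: "v = F b" by blast
    have "Re (\<phi> b) \<le> N b" using below_le[OF \<phi>, of b] complex_Re_le_cmod[of "\<phi> b"] by linarith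
    \<comment> \<open>Completing the square bounds F below by -1.\<close>
    moreover have "0 \<le> (N b - 1)\<^sup>2" by simp
    ultimately show "- 1 \<le> v" unfolding v F_def by (simp add: power2_diff)
  qed
  then have low: "Inf (range F) \<le> F b" for b by (simp add: cInf_lower)
  \<comment> \<open>The slack is the square of e because it becomes the constant term A of the
    discriminant lemma, whose conclusion is then the square of \<open>e * N a\<close>.\<close>
  have "Inf (range F) < Inf (range F) + e\<^sup>2" using e by simp
  then obtain b where b: "F b < Inf (range F) + e\<^sup>2"
    using cInf_lessD[of "range F"] by blast
  have rep: "cmod (\<phi> a - \<tau> (adj b * a)) \<le> e * N a" for a
  proof -
    have "(cmod (\<tau> (adj b * a) - \<phi> a))\<^sup>2 \<le> e\<^sup>2 * (N a)\<^sup>2"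
    proof (rule complex_quadratic_discriminant)
      fix c
      have "F (b + c *\<^sub>C a) = F b + 2 * Re (c * (\<tau> (adj b * a) - \<phi> a)) + (cmod c)\<^sup>2 * (N a)\<^sup>2"
      proof -
        have 1: "Re (cnj c * cnj (\<tau> (adj b * a))) = Re (c * \<tau> (adj b * a))" by simp
        have 2: "Re (cnj c * c * \<tau> (adj a * a)) = (cmod c)\<^sup>2 * (N a)\<^sup>2"
          unfolding N_square by (subst eq_Re) (simp add: cmod_power2 flip: power2_eq_square)
        show ?thesis
          unfolding F_def N_square[of "b + c *\<^sub>C a"] expand hermitian[of a b] plus_complex.sel 1 2
          by (simp add: N_square \<phi>.add \<phi>.scaleC right_diff_distrib)
      qed
      then show "0 \<le> e\<^sup>2 + 2 * Re (c * (\<tau> (adj b * a) - \<phi> a)) + (cmod c)\<^sup>2 * (N a)\<^sup>2"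
        using low[of "b + c *\<^sub>C a"] b by linarith
    qed simp
    then have "(cmod (\<phi> a - \<tau> (adj b * a)))\<^sup>2 \<le> (e * N a)\<^sup>2"
      by (simp add: norm_minus_commute power_mult_distrib)
    then show ?thesis by (rule power2_le_imp_le) (use e N_nonneg in simp)
  qed
  \<comment> \<open>By conjugation and traciality, b represents \<phi> as well as
    \<open>adj b\<close> does; their average is self-adjoint and inherits the error.\<close>
  have rep': "cmod (\<phi> a - \<tau> (b * a)) \<le> e * N a" for a
  proof -
    have "\<tau> (b * a) = cnj (\<tau> (adj b * adj a))"
      using adj[of "b * a"] trace[of "adj a" "adj b"] by (simp add: adj_mult)
    then have "\<phi> a - \<tau> (b * a) = cnj (\<phi> (adj a) - \<tau> (adj b * adj a))" by (simp add: \<phi>.adj)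
    then show ?thesis using rep[of "adj a"] by (simp only: complex_mod_cnj N_adj)
  qed
  define c where "c = (1/2) *\<^sub>R (b + adj b)"
  have "cmod (\<phi> a - \<tau> (c * a)) \<le> e * N a" for a
  proof -
    have "\<phi> a - \<tau> (c * a) = (1/2) *\<^sub>R ((\<phi> a - \<tau> (b * a)) + (\<phi> a - \<tau> (adj b * a)))"
      by (simp add: c_def distrib_right add scaleR scaleR_conv_of_real field_simps)
    also have "cmod \<dots> \<le> (1/2) * (e * N a + e * N a)"
      using norm_triangle_mono[OF rep'[of a] rep[of a]] by simp
    finally show ?thesis by simp
  qed
  moreover have "adj c = c" by (simp add: c_def adj_scaleR adj_add adj_adj add.commute)
  ultimately show ?thesis by blast
qed

definition apx :: "('a \<Rightarrow> complex) \<Rightarrow> nat \<Rightarrow> 'a" where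
  "apx \<phi> n = (SOME c. adj c = c \<and> (\<forall>a. cmod (\<phi> a - \<tau> (c * a)) \<le> err n * N a))"

lemma
  assumes "below \<phi>"
  shows adj_apx: "adj (apx \<phi> n) = apx \<phi> n"
    and apx: "cmod (\<phi> a - \<tau> (apx \<phi> n * a)) \<le> err n * N a"
  using someI_ex[OF approx_represent[OF assms err_bounds(1)[of n]]] unfolding apx_def by blast+

text \<open>Testing the representation on c = \<open>apx \<phi> n\<close> itself: one
  \<open>N c\<close> comes from the contraction \<phi>, the other from the error, as
  \<open>err n\<close> is at most 1.\<close>

lemma N_apx_le: assumes "below \<phi>" shows "N (apx \<phi> n) \<le> 2"
proof -
  define c where "c = apx \<phi> n"
  have "(N c)\<^sup>2 \<le> cmod (\<tau> (c * c))"
    using complex_Re_le_cmod[of "\<tau> (c * c)"] adj_apx[OF assms, of n] by (simp add: N_square c_def)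
  also have "\<dots> \<le> cmod (\<phi> c) + cmod (\<phi> c - \<tau> (c * c))"
    by (metis norm_triangle_sub norm_minus_commute)
  also have "\<dots> \<le> N c + err n * N c"
    using below_le[OF assms, of c] apx[OF assms, of c n] by (simp add: c_def)
  also have "\<dots> \<le> N c + 1 * N c" by (intro add_mono mult_right_mono err_bounds N_nonneg order_refl)
  finally have "N c * N c \<le> 2 * N c" by (simp add: power2_eq_square)
  then show ?thesis using N_nonneg[of c] by (cases "N c = 0") (simp_all add: c_def)
qed

text \<open>Both representation errors are tested on the difference d itself, where \<phi>(d)
  cancels; then one factor \<open>N d\<close> is divided out.\<close>

lemma N_apx_diff_le: assumes "below \<phi>" shows "N (apx \<phi> n - apx \<phi> k) \<le> err n + err k"
proof -
  define d where "d = apx \<phi> n - apx \<phi> k"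
  have "(N d)\<^sup>2 \<le> cmod (\<tau> (d * d))"
    using complex_Re_le_cmod[of "\<tau> (d * d)"] adj_apx[OF assms]
    by (simp add: N_square d_def adj_diff)
  also have "\<tau> (d * d) = (\<phi> d - \<tau> (apx \<phi> k * d)) - (\<phi> d - \<tau> (apx \<phi> n * d))"
    by (simp add: d_def left_diff_distrib diff)
  also have "cmod \<dots> \<le> err k * N d + err n * N d"
    by (rule order_trans[OF norm_triangle_ineq4 add_mono[OF apx[OF assms] apx[OF assms]]])
  finally have "N d * N d \<le> (err n + err k) * N d" by (simp add: power2_eq_square algebra_simps)
  then have "N d = 0 \<or> N d \<le> err n + err k"
    using N_nonneg[of d] mult_right_le_imp_le[of "N d" "N d"] by fastforce
  then show ?thesis
    using err_bounds(1)[of n] err_bounds(1)[of k] unfolding d_def by linarith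
qed

section \<open>Products of dominated traces\<close>

text \<open>If \<open>\<phi>\<close> and \<open>\<psi>\<close> correspond to the central operators \<open>h\<close> and \<open>k\<close> on
  \<open>L\<^sup>2(\<tau>)\<close>, then this functional corresponds to \<open>h k\<close>.\<close>
definition mult_trace :: "('a \<Rightarrow> complex) \<Rightarrow> ('a \<Rightarrow> complex) \<Rightarrow> 'a \<Rightarrow> complex" where
  "mult_trace \<phi> \<psi> d = lim (\<lambda>n. \<phi> (apx \<psi> n * d))"

lemma below_diff_apx_le:
  assumes "below \<phi>" "below \<psi>"
  shows "cmod (\<phi> (apx \<psi> n * d) - \<phi> (apx \<psi> k * d)) \<le> N d * (err n + err k)"
proof -
  interpret \<phi>: tracial_functional \<phi> using assms(1) by (simp add: below_def)
  have "cmod (\<phi> ((apx \<psi> n - apx \<psi> k) * d)) \<le> N (apx \<psi> n - apx \<psi> k) * N d"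
    by (rule below_mult_le[OF assms(1)])
  also have "\<dots> \<le> (err n + err k) * N d"
    by (intro mult_right_mono N_apx_diff_le assms N_nonneg)
  finally show ?thesis by (simp add: left_diff_distrib \<phi>.diff mult.commute)
qed

lemma
  assumes "below \<phi>" "below \<psi>"
  shows mult_trace_tendsto: "(\<lambda>n. \<phi> (apx \<psi> n * d)) \<longlonglongrightarrow> mult_trace \<phi> \<psi> d"
    and mult_trace_err: "cmod (\<phi> (apx \<psi> n * d) - mult_trace \<phi> \<psi> d) \<le> N d * err n"
  using convergent_of_err_bound[OF below_diff_apx_le[OF assms]] unfolding mult_trace_def by blast+

text \<open>Both terms are close to \<open>\<tau> (apx \<phi> m * x * apx \<psi> n * y)\<close>. This makes the product
  commutative and tracial.\<close>
lemma apx_exchange: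
  assumes \<phi>: "below \<phi>" and \<psi>: "below \<psi>"
  shows "cmod (\<phi> (x * apx \<psi> n * y) - \<psi> (y * apx \<phi> m * x)) \<le> 2 * norm x * norm y * (err n + err m)"
proof -
  define b c where "b = apx \<phi> m" and "c = apx \<psi> n"
  have bound: "N (u * apx \<rho> k * v) \<le> 2 * norm u * norm v" if "below \<rho>" for u v \<rho> k
  proof -
    have "norm u * N (apx \<rho> k) * norm v \<le> norm u * 2 * norm v"
      by (intro mult_right_mono mult_left_mono N_apx_le that) simp_all
    then show ?thesis using N_mult_mult_le[of u "apx \<rho> k" v] by simp
  qed
  have 1: "cmod (\<phi> (x * c * y) - \<tau> (b * (x * c * y))) \<le> err m * (2 * norm x * norm y)"
    unfolding b_def c_def
    by (rule order_trans[OF apx[OF \<phi>] mult_left_mono[OF bound[OF \<psi>]]]) simp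
  have 2: "cmod (\<psi> (y * b * x) - \<tau> (c * (y * b * x))) \<le> err n * (2 * norm y * norm x)"
    unfolding b_def c_def
    by (rule order_trans[OF apx[OF \<psi>] mult_left_mono[OF bound[OF \<phi>]]]) simp
  have 3: "\<tau> (c * (y * b * x)) = \<tau> (b * (x * c * y))"
    using trace[of "c * y" "b * x"] by (simp add: mult.assoc)
  have "\<phi> (x * c * y) - \<psi> (y * b * x) =
      (\<phi> (x * c * y) - \<tau> (b * (x * c * y))) - (\<psi> (y * b * x) - \<tau> (c * (y * b * x)))"
    using 3 by simp
  also have "cmod \<dots> \<le> err m * (2 * norm x * norm y) + err n * (2 * norm y * norm x)"
    by (rule order_trans[OF norm_triangle_ineq4 add_mono[OF 1 2]])
  finally show ?thesis by (simp add: b_def c_def algebra_simps del: of_nat_Suc)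
qed

text \<open>An asymptotic form of centrality: the approximant may stand between x and y. The
  arguments are swapped in the limit because \<open>apx_exchange\<close>, taken with m = n, passes
  from \<phi> to \<psi>.\<close>

lemma mult_trace_mid_tendsto:
  assumes \<phi>: "below \<phi>" and \<psi>: "below \<psi>"
  shows "(\<lambda>n. \<phi> (x * apx \<psi> n * y)) \<longlonglongrightarrow> mult_trace \<psi> \<phi> (x * y)"
proof (rule tendsto_of_err_bound)
  interpret \<psi>: tracial_functional \<psi> using \<psi> by (simp add: below_def)
  show "cmod (\<phi> (x * apx \<psi> n * y) - \<psi> (y * apx \<phi> n * x)) \<le> 4 * norm x * norm y * err n" for n
    using apx_exchange[OF assms, of x n y n] by (simp add: algebra_simps del: of_nat_Suc)
  have "\<psi> (y * apx \<phi> n * x) = \<psi> (apx \<phi> n * (x * y))" for n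
    using \<psi>.trace[of y "apx \<phi> n * x"] by (simp add: mult.assoc)
  then show "(\<lambda>n. \<psi> (y * apx \<phi> n * x)) \<longlonglongrightarrow> mult_trace \<psi> \<phi> (x * y)"
    using mult_trace_tendsto[OF \<psi> \<phi>] by simp
qed

text \<open>With x = 1 the previous limit concerns the very sequence that defines the left-hand
  side.\<close>

lemma mult_trace_commute:
  assumes "below \<phi>" "below \<psi>"
  shows "mult_trace \<phi> \<psi> = mult_trace \<psi> \<phi>"
proof
  fix d
  show "mult_trace \<phi> \<psi> d = mult_trace \<psi> \<phi> d"
    using LIMSEQ_unique[OF mult_trace_tendsto[OF assms] mult_trace_mid_tendsto[OF assms, of 1 d, simplified]] .
qed

text \<open>\<tau> itself corresponds to the identity operator.\<close>

lemma mult_trace_self: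
  assumes "below \<psi>" shows "mult_trace \<tau> \<psi> = \<psi>"
proof
  fix d
  have "(\<lambda>n. \<tau> (apx \<psi> n * d)) \<longlonglongrightarrow> \<psi> d"
  proof (rule tendsto_of_err_bound)
    show "cmod (\<tau> (apx \<psi> n * d) - \<psi> d) \<le> N d * err n" for n
      using apx[OF assms, of d n] by (simp only: norm_minus_commute mult.commute)
  qed simp
  then show "mult_trace \<tau> \<psi> d = \<psi> d"
    using mult_trace_tendsto[OF below_self assms] LIMSEQ_unique by blast
qed

lemma mult_trace_linear:
  assumes "below \<phi>" "below \<psi>"
  shows "Vector_Spaces.linear (*\<^sub>C) (*) (mult_trace \<phi> \<psi>)"
proof -
  interpret \<phi>: tracial_functional \<phi> using assms(1) by (simp add: below_def)
  note lim = mult_trace_tendsto[OF assms]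
  have "mult_trace \<phi> \<psi> (x + y) = mult_trace \<phi> \<psi> x + mult_trace \<phi> \<psi> y" for x y
    using LIMSEQ_unique[OF lim[of "x + y"]] tendsto_add[OF lim[of x] lim[of y]]
    by (simp add: distrib_left \<phi>.add)
  moreover have "mult_trace \<phi> \<psi> (c *\<^sub>C x) = c * mult_trace \<phi> \<psi> x" for c x
    using LIMSEQ_unique[OF lim[of "c *\<^sub>C x"]] tendsto_mult_left[OF lim[of x], of c]
    by (simp add: mult_scaleC_right \<phi>.scaleC)
  ultimately show ?thesis by (simp add: linear_scaleC_iff)
qed

text \<open>Cycling y to the front under \<phi> puts the approximant between y and x, where the
  limit is known.\<close>

lemma mult_trace_trace:
  assumes "below \<phi>" "below \<psi>"
  shows "mult_trace \<phi> \<psi> (x * y) = mult_trace \<phi> \<psi> (y * x)"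
proof -
  interpret \<phi>: tracial_functional \<phi> using assms(1) by (simp add: below_def)
  have "\<phi> (apx \<psi> n * (x * y)) = \<phi> (y * apx \<psi> n * x)" for n
    using \<phi>.trace[of "apx \<psi> n * x" y] by (simp add: mult.assoc)
  then have "(\<lambda>n. \<phi> (y * apx \<psi> n * x)) \<longlonglongrightarrow> mult_trace \<phi> \<psi> (x * y)"
    using mult_trace_tendsto[OF assms, of "x * y"] by simp
  then have "mult_trace \<phi> \<psi> (x * y) = mult_trace \<psi> \<phi> (y * x)"
    using mult_trace_mid_tendsto[OF assms, of y x] LIMSEQ_unique by blast
  then show ?thesis by (simp only: mult_trace_commute[OF assms])
qed

lemma mult_trace_norm_le:
  assumes \<phi>: "below \<phi>" and \<psi>: "below \<psi>"
  shows "cmod (mult_trace \<phi> \<psi> d) \<le> 2 * norm d"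
proof (rule LIMSEQ_le_const2)
  show "(\<lambda>n. cmod (\<phi> (apx \<psi> n * d))) \<longlonglongrightarrow> cmod (mult_trace \<phi> \<psi> d)"
    by (intro tendsto_norm mult_trace_tendsto assms)
  have "cmod (\<phi> (apx \<psi> n * d)) \<le> 2 * norm d" for n
    using below_mult_le[OF \<phi>, of "apx \<psi> n" d]
      mult_mono[OF N_apx_le[OF \<psi>, of n] N_le_norm[of d]] N_nonneg[of d] by simp
  then show "\<exists>M. \<forall>n\<ge>M. cmod (\<phi> (apx \<psi> n * d)) \<le> 2 * norm d" by blast
qed

text \<open>The approximants belong to \<psi> and are shared by all summands. Since
  \<open>apx\<close> makes arbitrary choices and need not be additive, sums in the second argument
  are reached through \<open>mult_trace_commute\<close>.\<close>

lemma mult_trace_sum_left: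
  assumes "\<And>j. j \<in> J \<Longrightarrow> below (\<phi> j)" and \<psi>: "below \<psi>"
    and "below \<rho>" and \<rho>: "\<And>a. \<rho> a = (\<Sum>j\<in>J. \<phi> j a)"
  shows "mult_trace \<rho> \<psi> d = (\<Sum>j\<in>J. mult_trace (\<phi> j) \<psi> d)"
proof -
  have "(\<lambda>n. \<Sum>j\<in>J. \<phi> j (apx \<psi> n * d)) \<longlonglongrightarrow> (\<Sum>j\<in>J. mult_trace (\<phi> j) \<psi> d)"
    by (intro tendsto_sum mult_trace_tendsto assms)
  then show ?thesis
    using LIMSEQ_unique mult_trace_tendsto[OF assms(3) \<psi>, of d] unfolding \<rho> by blast
qed

lemma mult_trace_diff_left:
  assumes \<phi>: "below \<phi>" "below \<phi>'" and \<psi>: "below \<psi>"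
    and "below \<rho>" and \<rho>: "\<And>a. \<rho> a = \<phi> a - \<phi>' a"
  shows "mult_trace \<rho> \<psi> d = mult_trace \<phi> \<psi> d - mult_trace \<phi>' \<psi> d"
proof -
  have "(\<lambda>n. \<phi> (apx \<psi> n * d) - \<phi>' (apx \<psi> n * d)) \<longlonglongrightarrow> mult_trace \<phi> \<psi> d - mult_trace \<phi>' \<psi> d"
    by (intro tendsto_diff mult_trace_tendsto assms)
  then show ?thesis
    using LIMSEQ_unique mult_trace_tendsto[OF assms(4) \<psi>, of d] unfolding \<rho> by blast
qed

section \<open>Squares of dominated traces\<close>

abbreviation square_trace :: "('a \<Rightarrow> complex) \<Rightarrow> 'a \<Rightarrow> complex" where
  "square_trace \<phi> \<equiv> mult_trace \<phi> \<phi>"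

text \<open>The square of h at \<open>adj a * a\<close> is the squared length of h a, which makes
  positivity evident.\<close>

lemma square_trace_tendsto:
  assumes \<phi>: "below \<phi>"
  shows "(\<lambda>n. complex_of_real ((N (apx \<phi> n * a))\<^sup>2)) \<longlonglongrightarrow> square_trace \<phi> (adj a * a)"
proof (rule tendsto_of_err_bound)
  show "(\<lambda>n. \<phi> (apx \<phi> n * (a * adj a))) \<longlonglongrightarrow> square_trace \<phi> (adj a * a)"
    using mult_trace_tendsto[OF \<phi> \<phi>, of "a * adj a"]
    by (simp only: mult_trace_trace[OF \<phi> \<phi>, of a "adj a"])
  fix n
  define c where "c = apx \<phi> n"
  have c: "adj c = c" "N c \<le> 2" using adj_apx[OF \<phi>] N_apx_le[OF \<phi>] by (simp_all add: c_def)
  have eq: "complex_of_real ((N (c * a))\<^sup>2) = \<tau> (c * (c * (a * adj a)))"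
    using trace[of "adj a" "c * (c * a)"]
    unfolding tau_eq_N[symmetric] adj_mult c(1) by (simp add: mult.assoc)
  have "N (c * (a * adj a)) \<le> N c * norm (a * adj a)" by (rule N_mult_le_left)
  also have "\<dots> \<le> 2 * norm (a * adj a)" by (intro mult_right_mono c) simp
  finally have le: "err n * N (c * (a * adj a)) \<le> err n * (2 * norm (a * adj a))"
    by (rule mult_left_mono) simp
  have "cmod (complex_of_real ((N (c * a))\<^sup>2) - \<phi> (c * (a * adj a))) \<le> (2 * norm (a * adj a)) * err n"
    using order_trans[OF apx[OF \<phi>, of "c * (a * adj a)" n] le] unfolding eq
    by (simp only: c_def norm_minus_commute mult.commute)
  then show "cmod (complex_of_real ((N (apx \<phi> n * a))\<^sup>2) - \<phi> (apx \<phi> n * (a * adj a)))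
      \<le> (2 * norm (a * adj a)) * err n" by (simp only: c_def)
qed

lemma square_trace_Re_tendsto:
  assumes "below \<phi>"
  shows "(\<lambda>n. (N (apx \<phi> n * a))\<^sup>2) \<longlonglongrightarrow> Re (square_trace \<phi> (adj a * a))"
  using tendsto_Re[OF square_trace_tendsto[OF assms, of a]] by simp

lemma square_trace_pos:
  assumes "below \<phi>" shows "square_trace \<phi> (adj a * a) \<in> \<real>\<^sub>\<ge>\<^sub>0"
proof -
  have "0 \<le> Re (square_trace \<phi> (adj a * a))"
    by (rule LIMSEQ_le_const[OF square_trace_Re_tendsto[OF assms]]) simp
  moreover have "Im (square_trace \<phi> (adj a * a)) = 0"
    using tendsto_Im[OF square_trace_tendsto[OF assms, of a]] by (simp add: LIMSEQ_const_iff)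
  ultimately show ?thesis by (simp add: complex_nonneg_Reals_iff)
qed

text \<open>This is h^2 \<le> h for a positive contraction. Cauchy-Schwarz for \<phi>, followed by
  domination by \<tau>, gives s \<le> sqrt t * sqrt s in the limit.\<close>

lemma square_trace_le:
  assumes \<phi>: "below \<phi>"
  shows "Re (square_trace \<phi> (adj a * a)) \<le> Re (\<phi> (adj a * a))"
proof -
  interpret \<phi>: tracial_functional \<phi> using \<phi> by (simp add: below_def)
  define s where "s = Re (square_trace \<phi> (adj a * a))"
  define t where "t = Re (\<phi> (adj a * a))"
  have s0: "0 \<le> s" using square_trace_pos[OF \<phi>, of a] by (simp add: s_def complex_nonneg_Reals_iff)
  have t0: "0 \<le> t" by (simp add: t_def \<phi>.Re_pos)
  have "Re (\<phi> (apx \<phi> n * (a * adj a))) \<le> sqrt t * sqrt ((N (apx \<phi> n * a))\<^sup>2)" for n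
  proof -
    have "Re (\<phi> (apx \<phi> n * (a * adj a))) \<le> cmod (\<phi> (adj a * (apx \<phi> n * a)))"
      using complex_Re_le_cmod \<phi>.trace[of "apx \<phi> n * a" "adj a"] by (simp add: mult.assoc)
    also have "\<dots> \<le> sqrt t * sqrt (Re (\<phi> (adj (apx \<phi> n * a) * (apx \<phi> n * a))))"
      unfolding t_def by (rule \<phi>.cauchy_schwarz')
    also have "\<dots> \<le> sqrt t * sqrt ((N (apx \<phi> n * a))\<^sup>2)"
      using \<phi> t0 unfolding below_def N_square by (intro mult_left_mono real_sqrt_le_mono) auto
    finally show ?thesis .
  qed
  moreover have "(\<lambda>n. Re (\<phi> (apx \<phi> n * (a * adj a)))) \<longlonglongrightarrow> s"
    using tendsto_Re[OF mult_trace_tendsto[OF \<phi> \<phi>, of "a * adj a"]]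
    by (simp only: s_def mult_trace_trace[OF \<phi> \<phi>, of a "adj a"])
  moreover have "(\<lambda>n. sqrt t * sqrt ((N (apx \<phi> n * a))\<^sup>2)) \<longlonglongrightarrow> sqrt t * sqrt s"
    unfolding s_def by (intro tendsto_mult_left tendsto_real_sqrt square_trace_Re_tendsto \<phi>)
  ultimately have "s \<le> sqrt t * sqrt s" using LIMSEQ_le by blast
  then have "sqrt s * sqrt s \<le> sqrt t * sqrt s" using s0 by simp
  then have "s = 0 \<or> sqrt s \<le> sqrt t"
    using s0 mult_right_le_imp_le[of "sqrt s" "sqrt s" "sqrt t"] by fastforce
  then have "sqrt s \<le> sqrt t" using t0 by auto
  then show ?thesis by (simp add: s_def t_def)
qed

lemma below_square_trace:
  assumes "below \<phi>" shows "below (square_trace \<phi>)"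
proof -
  have "tracial_functional (square_trace \<phi>)"
    by (intro tracial_functional.intro positive_functional.intro clinear_functional.intro
        positive_functional_axioms.intro tracial_functional_axioms.intro mult_trace_linear
        square_trace_pos mult_trace_trace exI[of _ 2] allI mult_trace_norm_le assms)
  moreover have "Re (square_trace \<phi> (adj a * a)) \<le> Re (\<tau> (adj a * a))" for a
    using square_trace_le[OF assms] assms unfolding below_def by (meson order_trans)
  ultimately show ?thesis by (simp add: below_def)
qed

lemma below_diff:
  assumes \<phi>: "below \<phi>" and \<psi>: "below \<psi>"
    and le: "\<And>a. Re (\<psi> (adj a * a)) \<le> Re (\<phi> (adj a * a))"
  shows "below (\<lambda>a. \<phi> a - \<psi> a)"
proof -
  interpret \<phi>: tracial_functional \<phi> using \<phi> by (simp add: below_def)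
  interpret \<psi>: tracial_functional \<psi> using \<psi> by (simp add: below_def)
  have "tracial_functional (\<lambda>a. \<phi> a - \<psi> a)"
  proof (intro tracial_functional.intro positive_functional.intro clinear_functional.intro
        positive_functional_axioms.intro tracial_functional_axioms.intro)
    show "Vector_Spaces.linear (*\<^sub>C) (*) (\<lambda>a. \<phi> a - \<psi> a)"
      by (simp add: linear_scaleC_iff \<phi>.add \<psi>.add \<phi>.scaleC \<psi>.scaleC right_diff_distrib)
    show "\<phi> (adj a * a) - \<psi> (adj a * a) \<in> \<real>\<^sub>\<ge>\<^sub>0" for a
      using le[of a] by (simp add: complex_nonneg_Reals_iff \<phi>.Im_pos \<psi>.Im_pos)
    have "cmod (\<phi> a - \<psi> a) \<le> (Re (\<phi> 1) + Re (\<psi> 1)) * norm a" for a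
      using order_trans[OF norm_triangle_ineq4 add_mono[OF \<phi>.norm_le \<psi>.norm_le]]
      by (simp add: distrib_right)
    then show "\<exists>C. \<forall>a. cmod (\<phi> a - \<psi> a) \<le> C * norm a" by blast
    show "\<phi> (a * b) - \<psi> (a * b) = \<phi> (b * a) - \<psi> (b * a)" for a b
      by (simp only: \<phi>.trace[of a] \<psi>.trace[of a])
  qed
  moreover have "Re (\<phi> (adj a * a) - \<psi> (adj a * a)) \<le> Re (\<tau> (adj a * a))" for a
  proof -
    have "Re (\<phi> (adj a * a)) \<le> Re (\<tau> (adj a * a))" using \<phi> by (simp add: below_def)
    then show ?thesis using \<psi>.Re_pos[of a] by simp
  qed
  ultimately show ?thesis by (simp add: below_def)
qed

section \<open>Positivity of products\<close>

text \<open>One of the two factors h in h^2 k is replaced by an approximant. The error is uniform in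
  the approximants of \<psi>, whose 2-norms are at most 2, so it survives their limit.\<close>

lemma square_trace_apx_le:
  assumes \<phi>: "below \<phi>" and \<psi>: "below \<psi>"
  shows "cmod (mult_trace (square_trace \<phi>) \<psi> d - mult_trace \<phi> \<psi> (apx \<phi> n * d)) \<le> 2 * norm d * err n"
proof (rule LIMSEQ_le_const2)
  define c where "c = apx \<phi> n"
  define b where "b = apx \<psi>"
  have "(\<lambda>m. \<phi> (c * b m * d)) \<longlonglongrightarrow> mult_trace \<phi> \<psi> (c * d)"
    unfolding b_def mult_trace_commute[OF \<phi> \<psi>] by (rule mult_trace_mid_tendsto[OF \<phi> \<psi>])
  moreover have "(\<lambda>m. square_trace \<phi> (b m * d)) \<longlonglongrightarrow> mult_trace (square_trace \<phi>) \<psi> d"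
    unfolding b_def by (intro mult_trace_tendsto below_square_trace \<phi> \<psi>)
  ultimately show "(\<lambda>m. cmod (square_trace \<phi> (b m * d) - \<phi> (c * b m * d)))
      \<longlonglongrightarrow> cmod (mult_trace (square_trace \<phi>) \<psi> d - mult_trace \<phi> \<psi> (apx \<phi> n * d))"
    unfolding c_def[symmetric] by (intro tendsto_norm tendsto_diff)
  have "cmod (square_trace \<phi> (b m * d) - \<phi> (c * b m * d)) \<le> 2 * norm d * err n" for m
  proof -
    have "cmod (square_trace \<phi> (b m * d) - \<phi> (c * b m * d)) \<le> N (b m * d) * err n"
      using mult_trace_err[OF \<phi> \<phi>, of n "b m * d"] unfolding c_def mult.assoc
      by (subst norm_minus_commute)
    also have "\<dots> \<le> N (b m) * norm d * err n" by (intro mult_right_mono N_mult_le_left) simp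
    also have "\<dots> \<le> 2 * norm d * err n"
      unfolding b_def by (intro mult_right_mono N_apx_le \<psi>) simp_all
    finally show ?thesis .
  qed
  then show "\<exists>M. \<forall>m\<ge>M. cmod (square_trace \<phi> (b m * d) - \<phi> (c * b m * d)) \<le> 2 * norm d * err n"
    by blast
qed

text \<open>The remaining factor h is replaced as well. Traciality first moves the fixed approximant
  to the right of d, producing the symmetric form needed for positivity.\<close>

lemma mult_trace_apx_le:
  assumes \<phi>: "below \<phi>" and \<psi>: "below \<psi>"
  shows "cmod (mult_trace \<phi> \<psi> (apx \<phi> n * d) - \<psi> (apx \<phi> n * d * apx \<phi> n)) \<le> 2 * norm d * err n"
proof (rule LIMSEQ_le)
  interpret \<psi>: tracial_functional \<psi> using \<psi> by (simp add: below_def)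
  define c where "c = apx \<phi>"
  have "(\<lambda>k. \<psi> (c k * (d * c n))) \<longlonglongrightarrow> mult_trace \<phi> \<psi> (c n * d)"
    using mult_trace_tendsto[OF \<psi> \<phi>, of "d * apx \<phi> n"] unfolding c_def
    by (simp only: mult_trace_commute[OF \<psi> \<phi>] mult_trace_trace[OF \<phi> \<psi>, of d])
  then show "(\<lambda>k. cmod (\<psi> (c k * (d * c n)) - \<psi> (c n * d * c n)))
      \<longlonglongrightarrow> cmod (mult_trace \<phi> \<psi> (apx \<phi> n * d) - \<psi> (apx \<phi> n * d * apx \<phi> n))"
    unfolding c_def by (intro tendsto_norm tendsto_diff tendsto_const)
  show "(\<lambda>k. 2 * norm d * (err k + err n)) \<longlonglongrightarrow> 2 * norm d * err n"
    using tendsto_mult_left[OF tendsto_add[OF LIMSEQ_inverse_real_of_nat tendsto_const[of "err n"]],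
        of "2 * norm d"] by (simp del: of_nat_Suc)
  have "cmod (\<psi> (c k * (d * c n)) - \<psi> (c n * d * c n)) \<le> 2 * norm d * (err k + err n)" for k
  proof -
    have "cmod (\<psi> (c k * (d * c n)) - \<psi> (c n * d * c n)) \<le> N (d * c n) * (err k + err n)"
      using below_diff_apx_le[OF \<psi> \<phi>, of k "d * c n" n] unfolding c_def mult.assoc .
    also have "\<dots> \<le> (norm d * N (c n)) * (err k + err n)"
      by (intro mult_right_mono N_mult_le_right) simp
    also have "\<dots> \<le> (norm d * 2) * (err k + err n)"
      unfolding c_def by (intro mult_right_mono mult_left_mono N_apx_le \<phi>) simp_all
    finally show ?thesis by (simp only: mult.commute)
  qed
  then show "\<exists>M. \<forall>k\<ge>M. cmod (\<psi> (c k * (d * c n)) - \<psi> (c n * d * c n)) \<le> 2 * norm d * (err k + err n)"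
    by blast
qed

text \<open>The operator counterpart is \<open>h\<^sup>2 k = h k h \<ge> 0\<close>.\<close>
lemma square_trace_mult_pos:
  assumes \<phi>: "below \<phi>" and \<psi>: "below \<psi>"
  shows "mult_trace (square_trace \<phi>) \<psi> (adj a * a) \<in> \<real>\<^sub>\<ge>\<^sub>0"
proof -
  interpret \<psi>: tracial_functional \<psi> using \<psi> by (simp add: below_def)
  define d where "d = adj a * a"
  define c where "c = apx \<phi>"
  have X: "(\<lambda>n. \<psi> (c n * d * c n)) \<longlonglongrightarrow> mult_trace (square_trace \<phi>) \<psi> d"
  proof (rule tendsto_of_err_bound)
    fix n
    have "mult_trace (square_trace \<phi>) \<psi> d - \<psi> (c n * d * c n) =
       (mult_trace (square_trace \<phi>) \<psi> d - mult_trace \<phi> \<psi> (c n * d)) +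
       (mult_trace \<phi> \<psi> (c n * d) - \<psi> (c n * d * c n))" by simp
    also have "cmod \<dots> \<le> 2 * norm d * err n + 2 * norm d * err n"
      unfolding c_def by (rule norm_triangle_mono[OF square_trace_apx_le[OF \<phi> \<psi>] mult_trace_apx_le[OF \<phi> \<psi>]])
    finally show "cmod (\<psi> (c n * d * c n) - mult_trace (square_trace \<phi>) \<psi> d) \<le> 4 * norm d * err n"
      by (simp add: norm_minus_commute)
  qed simp
  have eq: "c n * d * c n = adj (a * c n) * (a * c n)" for n
    by (simp add: d_def c_def adj_mult adj_apx[OF \<phi>] mult.assoc)
  have "0 \<le> Re (mult_trace (square_trace \<phi>) \<psi> d)"
    by (rule LIMSEQ_le_const[OF tendsto_Re[OF X]]) (simp add: eq \<psi>.Re_pos)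
  moreover have "Im (mult_trace (square_trace \<phi>) \<psi> d) = 0"
    using tendsto_Im[OF X] by (simp add: eq \<psi>.Im_pos LIMSEQ_const_iff)
  ultimately show ?thesis by (simp add: complex_nonneg_Reals_iff d_def)
qed

text \<open>The square root is the length of the vector representing \<phi>. So \<phi> is small as
  soon as its square is small at 1, which controls the Riesz-Nagy remainder.\<close>

lemma below_le_square_trace:
  assumes \<phi>: "below \<phi>"
  shows "cmod (\<phi> x) \<le> sqrt (Re (square_trace \<phi> 1)) * N x"
proof (rule LIMSEQ_le)
  show "(\<lambda>n. cmod (\<phi> x)) \<longlonglongrightarrow> cmod (\<phi> x)" by simp
  have "(\<lambda>n. sqrt ((N (apx \<phi> n))\<^sup>2)) \<longlonglongrightarrow> sqrt (Re (square_trace \<phi> 1))"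
    using square_trace_Re_tendsto[OF \<phi>, of 1] by (intro tendsto_real_sqrt) simp
  then have "(\<lambda>n. N (apx \<phi> n)) \<longlonglongrightarrow> sqrt (Re (square_trace \<phi> 1))"
    by (simp add: N_nonneg)
  from tendsto_add[OF tendsto_mult_right[OF this, of "N x"]
      tendsto_mult_right[OF LIMSEQ_inverse_real_of_nat, of "N x"]]
  show "(\<lambda>n. N (apx \<phi> n) * N x + err n * N x) \<longlonglongrightarrow> sqrt (Re (square_trace \<phi> 1)) * N x"
    by (simp del: of_nat_Suc)
  have "cmod (\<phi> x) \<le> N (apx \<phi> n) * N x + err n * N x" for n
    using order_trans[OF norm_triangle_sub add_mono[OF below_mult_le[OF below_self] apx[OF \<phi>]]] .
  then show "\<exists>M. \<forall>n\<ge>M. cmod (\<phi> x) \<le> N (apx \<phi> n) * N x + err n * N x" by blast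
qed

text \<open>The Riesz--Nagy iteration \<open>h \<mapsto> h - h\<^sup>2\<close> writes a positive contraction as a series of
  squares.\<close>
primrec square_remainder :: "('a \<Rightarrow> complex) \<Rightarrow> nat \<Rightarrow> 'a \<Rightarrow> complex" where
  "square_remainder \<phi> 0 = \<phi>"
| "square_remainder \<phi> (Suc n) =
     (\<lambda>a. square_remainder \<phi> n a - square_trace (square_remainder \<phi> n) a)"

lemma below_square_remainder: "below \<phi> \<Longrightarrow> below (square_remainder \<phi> n)"
  by (induction n) (simp_all add: below_diff below_square_trace square_trace_le)

text \<open>The squares at 1 are consecutive differences of the remainders at 1, a decreasing
  nonnegative and hence convergent sequence.\<close>

lemma square_remainder_tendsto:
  assumes \<phi>: "below \<phi>"
  shows "(\<lambda>n. Re (square_trace (square_remainder \<phi> n) 1)) \<longlonglongrightarrow> 0"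
proof -
  define X where "X n = Re (square_remainder \<phi> n 1)" for n
  have S: "Re (square_trace (square_remainder \<phi> n) 1) = X n - X (Suc n)" for n
    by (simp add: X_def)
  have pos: "0 \<le> X n" for n
  proof -
    interpret r: tracial_functional "square_remainder \<phi> n"
      using below_square_remainder[OF \<phi>, of n] by (simp add: below_def)
    show ?thesis using r.Re_pos[of 1] by (simp add: X_def)
  qed
  have "X (Suc n) \<le> X n" for n
    using square_trace_pos[OF below_square_remainder[OF \<phi>, of n], of 1] S[of n]
    by (simp add: complex_nonneg_Reals_iff)
  then have "decseq X" by (simp add: decseq_Suc_iff)
  then obtain L where L: "X \<longlonglongrightarrow> L" using decseq_convergent[of X 0] pos by blast
  show ?thesis unfolding S using tendsto_diff[OF L LIMSEQ_Suc[OF L]] by simp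
qed

text \<open>The difference from the n-th remainder term is a finite sum of positive terms h_i^2 k.
  The remainder term tends to 0 because its bound is uniform in the approximants of \<psi>, and the
  nonnegative reals are closed.\<close>

lemma mult_trace_pos:
  assumes \<phi>: "below \<phi>" and \<psi>: "below \<psi>"
  shows "mult_trace \<phi> \<psi> (adj a * a) \<in> \<real>\<^sub>\<ge>\<^sub>0"
proof -
  let ?r = "square_remainder \<phi>"
  define d where "d = adj a * a"
  note r = below_square_remainder[OF \<phi>]
  have step: "mult_trace \<phi> \<psi> d - mult_trace (?r n) \<psi> d \<in> \<real>\<^sub>\<ge>\<^sub>0" for n
  proof (induction n)
    case (Suc n)
    have "mult_trace (?r (Suc n)) \<psi> d =
        mult_trace (?r n) \<psi> d - mult_trace (square_trace (?r n)) \<psi> d"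
      using r[of n] r[of "Suc n"] by (intro mult_trace_diff_left) (simp_all add: below_square_trace \<psi>)
    moreover have "mult_trace (square_trace (?r n)) \<psi> d \<in> \<real>\<^sub>\<ge>\<^sub>0"
      unfolding d_def by (rule square_trace_mult_pos[OF r \<psi>])
    ultimately have "mult_trace \<phi> \<psi> d - mult_trace (?r (Suc n)) \<psi> d
        = (mult_trace \<phi> \<psi> d - mult_trace (?r n) \<psi> d) + mult_trace (square_trace (?r n)) \<psi> d"
      by simp
    then show ?case
      using nonneg_Reals_add_I[OF Suc \<open>mult_trace (square_trace (?r n)) \<psi> d \<in> \<real>\<^sub>\<ge>\<^sub>0\<close>] by metis
  qed simp
  have "(\<lambda>n. mult_trace (?r n) \<psi> d) \<longlonglongrightarrow> 0"
  proof (rule Lim_null_comparison)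
    have "cmod (mult_trace (?r n) \<psi> d) \<le> sqrt (Re (square_trace (?r n) 1)) * (2 * norm d)" for n
    proof (rule LIMSEQ_le_const2)
      show "(\<lambda>m. cmod (?r n (apx \<psi> m * d))) \<longlonglongrightarrow> cmod (mult_trace (?r n) \<psi> d)"
        by (intro tendsto_norm mult_trace_tendsto r \<psi>)
      have "cmod (?r n (apx \<psi> m * d)) \<le> sqrt (Re (square_trace (?r n) 1)) * (2 * norm d)" for m
      proof -
        have "0 \<le> Re (square_trace (?r n) 1)"
          using square_trace_pos[OF r[of n], of 1] by (simp add: complex_nonneg_Reals_iff)
        moreover have "N (apx \<psi> m * d) \<le> 2 * norm d"
          by (rule order_trans[OF N_mult_le_left mult_right_mono[OF N_apx_le[OF \<psi>]]]) simp
        ultimately show ?thesis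
          by (intro order_trans[OF below_le_square_trace[OF r[of n]]] mult_left_mono) simp_all
      qed
      then show "\<exists>M. \<forall>m\<ge>M. cmod (?r n (apx \<psi> m * d)) \<le> sqrt (Re (square_trace (?r n) 1)) * (2 * norm d)"
        by blast
    qed
    then show "\<forall>\<^sub>F n in sequentially. cmod (mult_trace (?r n) \<psi> d)
        \<le> sqrt (Re (square_trace (?r n) 1)) * (2 * norm d)"
      by (rule always_eventually[OF allI])
    show "(\<lambda>n. sqrt (Re (square_trace (?r n) 1)) * (2 * norm d)) \<longlonglongrightarrow> 0"
      by (rule tendsto_mult_left_zero)
        (rule tendsto_real_sqrt[OF square_remainder_tendsto[OF \<phi>], unfolded real_sqrt_zero])
  qed
  then have X: "(\<lambda>n. mult_trace \<phi> \<psi> d - mult_trace (?r n) \<psi> d) \<longlonglongrightarrow> mult_trace \<phi> \<psi> d"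
    using tendsto_diff[OF tendsto_const[of "mult_trace \<phi> \<psi> d"]] by fastforce
  have "mult_trace \<phi> \<psi> d \<in> \<real>\<^sub>\<ge>\<^sub>0"
    by (rule closed_sequentially[OF closed_nonneg_Reals_complex _ X]) (rule step)
  then show ?thesis by (simp add: d_def)
qed

lemma tracial_functional_mult_trace:
  assumes "below \<phi>" "below \<psi>" shows "tracial_functional (mult_trace \<phi> \<psi>)"
  by (intro tracial_functional.intro positive_functional.intro clinear_functional.intro
      positive_functional_axioms.intro tracial_functional_axioms.intro mult_trace_linear
      mult_trace_pos mult_trace_trace exI[of _ 2] allI mult_trace_norm_le assms)

end

section \<open>Riesz decomposition\<close>

lemma (in positive_functional) bounded_linear: "bounded_linear f"
proof
  show "\<exists>K. \<forall>x. norm (f x) \<le> norm x * K" using bounded by (metis mult.commute)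
qed (simp_all add: add scaleR)

lemma tracial_states_iff: "\<tau> \<in> tracial_states \<longleftrightarrow> normalized_trace (blinfun_apply \<tau>)"
proof
  assume "\<tau> \<in> tracial_states"
  then have "tracial_state (blinfun_apply \<tau>)" by (simp add: tracial_states_def)
  moreover have "\<exists>C. \<forall>a. cmod (blinfun_apply \<tau> a) \<le> C * norm a" using norm_blinfun by blast
  ultimately show "normalized_trace (blinfun_apply \<tau>)"
    unfolding tracial_state_def
    by (intro normalized_trace.intro normalized_trace_axioms.intro tracial_functional.intro
        tracial_functional_axioms.intro positive_functional.intro clinear_functional.intro
        positive_functional_axioms.intro) blast+
next
  assume "normalized_trace (blinfun_apply \<tau>)"
  then interpret normalized_trace "blinfun_apply \<tau>" .
  show "\<tau> \<in> tracial_states"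
    using linear pos one trace by (auto simp: tracial_states_def tracial_state_def dual_space_def)
qed

lemma tracial_functional_scaleR:
  assumes "tracial_functional f" "0 \<le> r"
  shows "tracial_functional (\<lambda>a. r *\<^sub>R f a)"
proof -
  interpret f: tracial_functional f by fact
  show ?thesis
  proof (intro tracial_functional.intro positive_functional.intro clinear_functional.intro
      positive_functional_axioms.intro tracial_functional_axioms.intro)
    show "Vector_Spaces.linear (*\<^sub>C) (*) (\<lambda>a. r *\<^sub>R f a)"
      by (simp add: linear_scaleC_iff f.add f.scaleC scaleR_add_right)
    show "r *\<^sub>R f (adj a * a) \<in> \<real>\<^sub>\<ge>\<^sub>0" for a
      using f.Re_pos[of a] f.Im_pos[of a] assms(2) by (simp add: complex_nonneg_Reals_iff)
    have "cmod (r *\<^sub>R f a) \<le> (r * Re (f 1)) * norm a" for a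
      using mult_left_mono[OF f.norm_le assms(2)] assms(2) by (simp add: mult.assoc)
    then show "\<exists>C. \<forall>a. cmod (r *\<^sub>R f a) \<le> C * norm a" by blast
    show "r *\<^sub>R f (a * b) = r *\<^sub>R f (b * a)" for a b by (simp only: f.trace[of a])
  qed
qed

text \<open>If f(1) = 0 then f = 0 by \<open>norm_le\<close>, and p serves as the tracial state
  carrying coefficient 0.\<close>

lemma tracial_functional_normalize:
  fixes f :: "'a::unital_cstar_algebra \<Rightarrow> complex" and p :: "'a \<Rightarrow>\<^sub>L complex"
  assumes f: "tracial_functional f" and p: "p \<in> tracial_states"
  shows "\<exists>z\<in>tracial_states. \<forall>a. f a = Re (f 1) *\<^sub>R blinfun_apply z a"
proof -
  interpret f: tracial_functional f by fact
  have f1: "0 \<le> Re (f 1)" "f 1 = of_real (Re (f 1))" using f.Re_pos[of 1] f.eq_Re[of 1] by simp_all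
  show ?thesis
  proof (cases "Re (f 1) = 0")
    case True
    then have "f a = 0" for a using f.norm_le[of a] by simp
    then show ?thesis using p True by (intro bexI[of _ p]) simp_all
  next
    case False
    define g where "g = (\<lambda>a. inverse (Re (f 1)) *\<^sub>R f a)"
    have g: "normalized_trace g"
    proof (intro normalized_trace.intro normalized_trace_axioms.intro)
      show "tracial_functional g" unfolding g_def by (rule tracial_functional_scaleR[OF f]) (simp add: f1(1))
      have "g 1 = inverse (Re (f 1)) *\<^sub>R of_real (Re (f 1))"
        unfolding g_def by (rule arg_cong[OF f1(2)])
      also have "\<dots> = 1" using False by (simp add: scaleR_conv_of_real)
      finally show "g 1 = 1" .
    qed
    then interpret g: normalized_trace g .
    have Z: "blinfun_apply (Blinfun g) = g" by (rule bounded_linear_Blinfun_apply[OF g.bounded_linear])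
    show ?thesis
    proof (intro bexI allI)
      show "f a = Re (f 1) *\<^sub>R blinfun_apply (Blinfun g) a" for a
        using False by (simp add: Z) (simp add: g_def)
      show "Blinfun g \<in> tracial_states" unfolding tracial_states_iff Z by (rule g)
    qed
  qed
qed

lemma convex_tracial_states: "convex (tracial_states :: ('a::unital_cstar_algebra \<Rightarrow>\<^sub>L complex) set)"
proof (rule convexI)
  fix x y :: "'a \<Rightarrow>\<^sub>L complex" and u v :: real
  assume xy: "x \<in> tracial_states" "y \<in> tracial_states" and uv: "0 \<le> u" "0 \<le> v" "u + v = 1"
  interpret x: normalized_trace "blinfun_apply x" using xy by (simp add: tracial_states_iff)
  interpret y: normalized_trace "blinfun_apply y" using xy by (simp add: tracial_states_iff)
  have lin: "Vector_Spaces.linear (*\<^sub>C) (*) (blinfun_apply (u *\<^sub>R x + v *\<^sub>R y))"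
    by (simp add: linear_scaleC_iff blinfun.bilinear_simps x.add y.add x.scaleC y.scaleC algebra_simps)
  show "u *\<^sub>R x + v *\<^sub>R y \<in> tracial_states"
    unfolding tracial_states_def dual_space_def tracial_state_def mem_Collect_eq
  proof (intro conjI allI lin)
    show "blinfun_apply (u *\<^sub>R x + v *\<^sub>R y) (adj a * a) \<in> \<real>\<^sub>\<ge>\<^sub>0" for a
      using uv x.Re_pos[of a] x.Im_pos[of a] y.Re_pos[of a] y.Im_pos[of a]
      by (simp add: complex_nonneg_Reals_iff blinfun.bilinear_simps)
    show "blinfun_apply (u *\<^sub>R x + v *\<^sub>R y) 1 = 1"
      using uv by (simp add: blinfun.bilinear_simps x.one y.one scaleR_conv_of_real flip: of_real_add)
    show "blinfun_apply (u *\<^sub>R x + v *\<^sub>R y) (a * b) = blinfun_apply (u *\<^sub>R x + v *\<^sub>R y) (b * a)" for a b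
      by (simp add: blinfun.bilinear_simps x.trace[of a] y.trace[of a])
  qed
qed

lemma riesz_decomposition_tracial_states:
  "riesz_decomposition_property (tracial_states :: ('a::unital_cstar_algebra \<Rightarrow>\<^sub>L complex) set)"
  unfolding riesz_decomposition_property_def
proof (intro allI impI)
  fix n m :: nat and \<alpha> \<beta> :: "nat \<Rightarrow> real" and x y :: "nat \<Rightarrow> 'a \<Rightarrow>\<^sub>L complex" and p
  assume H: "(\<forall>j\<in>{1..n}. x j \<in> tracial_states \<and> 0 < \<alpha> j) \<and>
    (\<forall>i\<in>{1..m}. y i \<in> tracial_states \<and> 0 < \<beta> i) \<and>
    (\<Sum>j = 1..n. \<alpha> j) = 1 \<and> (\<Sum>i = 1..m. \<beta> i) = 1 \<and>
    p = (\<Sum>j = 1..n. \<alpha> j *\<^sub>R x j) \<and> p = (\<Sum>i = 1..m. \<beta> i *\<^sub>R y i)"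
  then have p_x: "p = (\<Sum>j = 1..n. \<alpha> j *\<^sub>R x j)" and p_y: "p = (\<Sum>i = 1..m. \<beta> i *\<^sub>R y i)"
    by blast+
  \<comment> \<open>As a convex combination p is itself a tracial state, so it can serve as the
    reference trace.\<close>
  have p: "p \<in> tracial_states"
    unfolding p_x using H by (intro convex_sum convex_tracial_states) (auto intro: less_imp_le)
  then interpret normalized_trace "blinfun_apply p" by (simp add: tracial_states_iff)
  \<comment> \<open>The other summands are nonnegative on \<open>adj a * a\<close>. The family is
    arbitrary so that both decompositions of p are covered.\<close>
  have below_summand: "below (\<lambda>a. \<delta> k *\<^sub>R blinfun_apply (w k) a)"
    if w: "\<And>j. j \<in> J \<Longrightarrow> w j \<in> tracial_states \<and> 0 < \<delta> j" and J: "finite J"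
      and pw: "p = (\<Sum>j\<in>J. \<delta> j *\<^sub>R w j)" and k: "k \<in> J"
    for w :: "nat \<Rightarrow> 'a \<Rightarrow>\<^sub>L complex" and \<delta> J k
    unfolding below_def
  proof (intro conjI allI)
    have tf: "tracial_functional (blinfun_apply (w j))" if "j \<in> J" for j
      using w[OF that] by (simp add: tracial_states_iff normalized_trace_def)
    show "tracial_functional (\<lambda>a. \<delta> k *\<^sub>R blinfun_apply (w k) a)"
      using w[OF k] by (intro tracial_functional_scaleR tf k) simp
    fix a
    have "\<delta> k * Re (blinfun_apply (w k) (adj a * a)) \<le> (\<Sum>j\<in>J. \<delta> j * Re (blinfun_apply (w j) (adj a * a)))"
    proof (rule member_le_sum[OF k _ J])
      fix j assume "j \<in> J - {k}"
      then have j: "j \<in> J" by simp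
      interpret tracial_functional "blinfun_apply (w j)" by (rule tf[OF j])
      show "0 \<le> \<delta> j * Re (blinfun_apply (w j) (adj a * a))" using w[OF j] Re_pos by simp
    qed
    then show "Re (\<delta> k *\<^sub>R blinfun_apply (w k) (adj a * a)) \<le> Re (blinfun_apply p (adj a * a))"
      unfolding pw by (simp add: blinfun.bilinear_simps)
  qed
  define X where "X j = (\<lambda>a. \<alpha> j *\<^sub>R blinfun_apply (x j) a)" for j
  define Y where "Y i = (\<lambda>a. \<beta> i *\<^sub>R blinfun_apply (y i) a)" for i
  have X: "below (X j)" if "j \<in> {1..n}" for j
    unfolding X_def using H that by (intro below_summand[OF _ _ p_x]) auto
  have Y: "below (Y i)" if "i \<in> {1..m}" for i
    unfolding Y_def using H that by (intro below_summand[OF _ _ p_y]) auto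
  have p_X: "blinfun_apply p a = (\<Sum>j = 1..n. X j a)" for a
    unfolding p_x X_def by (simp add: blinfun.bilinear_simps)
  have p_Y: "blinfun_apply p a = (\<Sum>i = 1..m. Y i a)" for a
    unfolding p_y Y_def by (simp add: blinfun.bilinear_simps)
  \<comment> \<open>The weight of a cell is the mass at 1 of its product functional; the state
    \<open>z i j\<close> is the normalised product.\<close>
  define \<gamma> where "\<gamma> i j = Re (mult_trace (X j) (Y i) 1)" for i j
  have "\<forall>i j. \<exists>z. i \<in> {1..m} \<and> j \<in> {1..n} \<longrightarrow>
      z \<in> tracial_states \<and> (\<forall>a. mult_trace (X j) (Y i) a = \<gamma> i j *\<^sub>R blinfun_apply z a)"
    using tracial_functional_normalize[OF tracial_functional_mult_trace[OF X Y] p]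
    unfolding \<gamma>_def by blast
  then obtain z where z': "\<forall>i j. i \<in> {1..m} \<and> j \<in> {1..n} \<longrightarrow>
      z i j \<in> tracial_states \<and> (\<forall>a. mult_trace (X j) (Y i) a = \<gamma> i j *\<^sub>R blinfun_apply (z i j) a)"
    by metis
  have zT: "z i j \<in> tracial_states"
    and z: "mult_trace (X j) (Y i) a = \<gamma> i j *\<^sub>R blinfun_apply (z i j) a"
    if "i \<in> {1..m}" "j \<in> {1..n}" for i j a
    using z' that by blast+
  have \<gamma>_nonneg: "0 \<le> \<gamma> i j" if "i \<in> {1..m}" "j \<in> {1..n}" for i j
    using mult_trace_pos[OF X[OF that(2)] Y[OF that(1)], of 1]
    by (simp add: \<gamma>_def complex_nonneg_Reals_iff)
  \<comment> \<open>The operators h_j sum to the identity, so the products h_j k_i sum to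
    k_i.\<close>
  have sum_j: "(\<Sum>j = 1..n. mult_trace (X j) (Y i) a) = Y i a" if i: "i \<in> {1..m}" for i a
    using mult_trace_sum_left[of "{1..n}" X "Y i" "blinfun_apply p" a] X Y[OF i] below_self p_X
      mult_trace_self[OF Y[OF i]] by simp
  have sum_i: "(\<Sum>i = 1..m. mult_trace (X j) (Y i) a) = X j a" if j: "j \<in> {1..n}" for j a
  proof -
    have "(\<Sum>i = 1..m. mult_trace (X j) (Y i) a) = (\<Sum>i = 1..m. mult_trace (Y i) (X j) a)"
      by (intro sum.cong refl) (simp only: mult_trace_commute[OF X[OF j] Y])
    then show ?thesis
      using mult_trace_sum_left[of "{1..m}" Y "X j" "blinfun_apply p" a] Y X[OF j] below_self p_Y
        mult_trace_self[OF X[OF j]] by simp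
  qed
  have X1: "X j 1 = of_real (\<alpha> j)" if "j \<in> {1..n}" for j
    using H that by (simp add: X_def tracial_states_iff normalized_trace_def normalized_trace_axioms_def
        scaleR_conv_of_real)
  have Y1: "Y i 1 = of_real (\<beta> i)" if "i \<in> {1..m}" for i
    using H that by (simp add: Y_def tracial_states_iff normalized_trace_def normalized_trace_axioms_def
        scaleR_conv_of_real)
  have \<alpha>: "\<alpha> j = (\<Sum>i = 1..m. \<gamma> i j)" if "j \<in> {1..n}" for j
    using arg_cong[OF sum_i[OF that, of 1], of Re] X1[OF that] by (simp add: \<gamma>_def)
  have \<beta>: "\<beta> i = (\<Sum>j = 1..n. \<gamma> i j)" if "i \<in> {1..m}" for i
    using arg_cong[OF sum_j[OF that, of 1], of Re] Y1[OF that] by (simp add: \<gamma>_def)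
  have x: "\<alpha> j *\<^sub>R x j = (\<Sum>i = 1..m. \<gamma> i j *\<^sub>R z i j)" if j: "j \<in> {1..n}" for j
    using sum_i[OF j] z[OF _ j] by (intro blinfun_eqI) (simp add: X_def blinfun.bilinear_simps)
  have y: "\<beta> i *\<^sub>R y i = (\<Sum>j = 1..n. \<gamma> i j *\<^sub>R z i j)" if i: "i \<in> {1..m}" for i
    using sum_j[OF i] z[OF i] by (intro blinfun_eqI) (simp add: Y_def blinfun.bilinear_simps)
  show "\<exists>z \<gamma>. (\<forall>i\<in>{1..m}. \<forall>j\<in>{1..n}. z i j \<in> tracial_states \<and> 0 \<le> \<gamma> i j) \<and>
      (\<Sum>i = 1..m. \<Sum>j = 1..n. \<gamma> i j) = 1 \<and>
      p = (\<Sum>i = 1..m. \<Sum>j = 1..n. \<gamma> i j *\<^sub>R z i j) \<and>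
      (\<forall>j\<in>{1..n}. \<alpha> j = (\<Sum>i = 1..m. \<gamma> i j)) \<and>
      (\<forall>i\<in>{1..m}. \<beta> i = (\<Sum>j = 1..n. \<gamma> i j)) \<and>
      (\<forall>j\<in>{1..n}. x j = (\<Sum>i = 1..m. (inverse (\<alpha> j) * \<gamma> i j) *\<^sub>R z i j)) \<and>
      (\<forall>i\<in>{1..m}. y i = (\<Sum>j = 1..n. (inverse (\<beta> i) * \<gamma> i j) *\<^sub>R z i j))"
  proof (intro exI[of _ z] exI[of _ \<gamma>] conjI ballI)
    show "(\<Sum>i = 1..m. \<Sum>j = 1..n. \<gamma> i j) = 1"
    proof -
      have "(\<Sum>i = 1..m. \<Sum>j = 1..n. \<gamma> i j) = (\<Sum>i = 1..m. \<beta> i)"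
        by (intro sum.cong refl \<beta>[symmetric])
      then show ?thesis using H by simp
    qed
    show "p = (\<Sum>i = 1..m. \<Sum>j = 1..n. \<gamma> i j *\<^sub>R z i j)"
      unfolding p_y by (intro sum.cong refl y)
    show "x j = (\<Sum>i = 1..m. (inverse (\<alpha> j) * \<gamma> i j) *\<^sub>R z i j)" if j: "j \<in> {1..n}" for j
    proof -
      have "inverse (\<alpha> j) *\<^sub>R (\<alpha> j *\<^sub>R x j) = (\<Sum>i = 1..m. (inverse (\<alpha> j) * \<gamma> i j) *\<^sub>R z i j)"
        unfolding x[OF j] by (simp add: scaleR_sum_right)
      moreover have "\<alpha> j \<noteq> 0" using H j by force
      ultimately show ?thesis by simp
    qed
    show "y i = (\<Sum>j = 1..n. (inverse (\<beta> i) * \<gamma> i j) *\<^sub>R z i j)" if i: "i \<in> {1..m}" for i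
    proof -
      have "inverse (\<beta> i) *\<^sub>R (\<beta> i *\<^sub>R y i) = (\<Sum>j = 1..n. (inverse (\<beta> i) * \<gamma> i j) *\<^sub>R z i j)"
        unfolding y[OF i] by (simp add: scaleR_sum_right)
      moreover have "\<beta> i \<noteq> 0" using H i by force
      ultimately show ?thesis by simp
    qed
  qed (use zT \<gamma>_nonneg \<alpha> \<beta> in blast)+
qed

section \<open>The weak* topology\<close>

lemma continuous_map_scaleR:
  fixes g :: "'b \<Rightarrow> 'c::real_normed_vector"
  assumes "continuous_map X euclideanreal f" "continuous_map X euclidean g"
  shows "continuous_map X euclidean (\<lambda>x. f x *\<^sub>R g x)"
  using assms by (simp add: continuous_map_atin tendsto_scaleR)

lemma openin_weak_star_topology:
  "openin weak_star_topology S \<longleftrightarrow> (\<exists>U. open U \<and> S = blinfun_apply -` U \<inter> dual_space)"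
  by (simp add: weak_star_topology_def openin_pullback_topology euclidean_product_topology flip: open_openin)

lemma topspace_weak_star_topology [simp]: "topspace weak_star_topology = dual_space"
  by (simp add: weak_star_topology_def topspace_pullback_topology)

lemma continuous_map_weak_star_apply:
  "continuous_map weak_star_topology euclidean (\<lambda>\<phi>. blinfun_apply \<phi> a)"
  unfolding weak_star_topology_def
  using continuous_map_pullback[OF continuous_map_product_projection[of a UNIV "\<lambda>_. euclidean"]]
  by (simp add: comp_def)

text \<open>The universal property of an initial topology; it serves for addition, scaling and the
  inverse map in the compactness proof.\<close>

lemma continuous_map_into_weak_star:
  assumes "\<And>a. continuous_map X euclidean (\<lambda>x. blinfun_apply (g x) a)"
    and "\<And>x. x \<in> topspace X \<Longrightarrow> g x \<in> dual_space"
  shows "continuous_map X weak_star_topology g"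
  unfolding weak_star_topology_def
  by (rule continuous_map_pullback')
    (use assms in \<open>auto simp: continuous_map_componentwise_UNIV comp_def\<close>)

lemma subspace_dual_space: "subspace (dual_space :: ('a::unital_cstar_algebra \<Rightarrow>\<^sub>L complex) set)"
  by (rule subspaceI)
    (simp_all add: dual_space_def linear_scaleC_iff blinfun.bilinear_simps algebra_simps)

lemma Hausdorff_weak_star_topology:
  "Hausdorff_space (weak_star_topology :: ('a::unital_cstar_algebra \<Rightarrow>\<^sub>L complex) topology)"
  unfolding Hausdorff_space_def topspace_weak_star_topology
proof (intro allI impI)
  fix f g :: "'a \<Rightarrow>\<^sub>L complex"
  assume fg: "f \<in> dual_space \<and> g \<in> dual_space \<and> f \<noteq> g"
  then obtain a where "blinfun_apply f a \<noteq> blinfun_apply g a" using blinfun_eqI by blast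
  then obtain U V where UV: "open U" "open V" "blinfun_apply f a \<in> U" "blinfun_apply g a \<in> V" "U \<inter> V = {}"
    by (metis hausdorff)
  have op: "openin weak_star_topology {\<phi> \<in> dual_space. blinfun_apply \<phi> a \<in> W}" if "open W" for W
    using openin_continuous_map_preimage[OF continuous_map_weak_star_apply, of W a] that
    by (simp flip: open_openin)
  show "\<exists>U V. openin weak_star_topology U \<and> openin weak_star_topology V \<and> f \<in> U \<and> g \<in> V \<and> disjnt U V"
    using op[OF UV(1)] op[OF UV(2)] UV fg
    by (intro exI[of _ "{\<phi> \<in> dual_space. blinfun_apply \<phi> a \<in> U}"]
        exI[of _ "{\<phi> \<in> dual_space. blinfun_apply \<phi> a \<in> V}"]) (auto simp: disjnt_def)
qed

lemma locally_convex_weak_star_topology: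
  "locally_convex_space (weak_star_topology :: ('a::unital_cstar_algebra \<Rightarrow>\<^sub>L complex) topology)"
  unfolding locally_convex_space_def topspace_weak_star_topology
proof (intro conjI allI impI)
  let ?T = "weak_star_topology :: ('a \<Rightarrow>\<^sub>L complex) topology"
  note [simp] = subspace_add[OF subspace_dual_space] subspace_scale[OF subspace_dual_space]
  show "continuous_map (prod_topology ?T ?T) ?T (\<lambda>(x, y). x + y)"
  proof (rule continuous_map_into_weak_star)
    fix a
    have "continuous_map (prod_topology ?T ?T) euclidean
       (\<lambda>p. blinfun_apply (fst p) a + blinfun_apply (snd p) a)"
      by (intro continuous_map_add
          continuous_map_compose[OF continuous_map_fst continuous_map_weak_star_apply, unfolded comp_def]
          continuous_map_compose[OF continuous_map_snd continuous_map_weak_star_apply, unfolded comp_def])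
    then show "continuous_map (prod_topology ?T ?T) euclidean
        (\<lambda>p. blinfun_apply (case p of (x, y) \<Rightarrow> x + y) a)"
      by (simp add: case_prod_unfold blinfun.bilinear_simps)
  qed auto
  show "continuous_map (prod_topology euclideanreal ?T) ?T (\<lambda>(c, x). c *\<^sub>R x)"
  proof (rule continuous_map_into_weak_star)
    fix a
    have "continuous_map (prod_topology euclideanreal ?T) euclidean
       (\<lambda>p. fst p *\<^sub>R blinfun_apply (snd p) a)"
      by (intro continuous_map_scaleR continuous_map_fst
          continuous_map_compose[OF continuous_map_snd continuous_map_weak_star_apply, unfolded comp_def])
    then show "continuous_map (prod_topology euclideanreal ?T) euclidean
        (\<lambda>p. blinfun_apply (case p of (c, x) \<Rightarrow> c *\<^sub>R x) a)"
      by (simp add: case_prod_unfold blinfun.bilinear_simps)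
  qed auto
  show "\<exists>V. openin ?T V \<and> convex V \<and> 0 \<in> V \<and> V \<subseteq> U" if U: "openin ?T U \<and> 0 \<in> U" for U
  proof -
    from U obtain O' where O': "open O'" "U = blinfun_apply -` O' \<inter> dual_space"
      by (auto simp: openin_weak_star_topology)
    have "openin (product_topology (\<lambda>_::'a. euclidean) UNIV) O'"
      using O'(1) by (simp add: euclidean_product_topology flip: open_openin)
    moreover have "blinfun_apply 0 \<in> O'" using U O'(2) by auto
    ultimately obtain X where X: "blinfun_apply 0 \<in> (\<Pi>\<^sub>E i\<in>UNIV. X i)" "\<And>i::'a. open (X i)"
        "finite {i. X i \<noteq> UNIV}" "(\<Pi>\<^sub>E i\<in>UNIV. X i) \<subseteq> O'"
      using product_topology_open_contains_basis[of "\<lambda>_. euclidean" UNIV O' "blinfun_apply 0"]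
      by (auto simp flip: open_openin)
    have "\<forall>i. \<exists>e>0. ball 0 e \<subseteq> X i"
    proof
      fix i
      have "0 \<in> X i" using X(1) by (auto simp: PiE_iff)
      then show "\<exists>e>0. ball 0 e \<subseteq> X i" using X(2)[of i] openE by blast
    qed
    then obtain e where e: "\<And>i. 0 < e i" "\<And>i. ball 0 (e i) \<subseteq> X i" by metis
    \<comment> \<open>A basic product neighbourhood restricts finitely many coordinates; shrinking
      these to balls gives a convex cylinder.\<close>
    define J where "J = {i. X i \<noteq> UNIV}"
    define V where "V = {\<phi> \<in> dual_space. \<forall>i\<in>J. blinfun_apply \<phi> i \<in> ball 0 (e i)}"
    \<comment> \<open>The outer \<open>dual_space\<close> covers empty J, where the bare
      intersection would be \<open>UNIV\<close>.\<close>
    have "V = dual_space \<inter> (\<Inter>i\<in>J. {\<phi> \<in> dual_space. blinfun_apply \<phi> i \<in> ball 0 (e i)})"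
      by (auto simp: V_def)
    moreover have "openin ?T \<dots>"
    proof (rule openin_Int_Inter)
      show "finite ((\<lambda>i. {\<phi> \<in> dual_space. blinfun_apply \<phi> i \<in> ball 0 (e i)}) ` J)"
        using X(3) by (simp add: J_def)
      show "openin ?T dual_space" using openin_topspace[of ?T] by simp
      show "openin ?T W" if "W \<in> (\<lambda>i. {\<phi> \<in> dual_space. blinfun_apply \<phi> i \<in> ball 0 (e i)}) ` J" for W
        using that openin_continuous_map_preimage[OF continuous_map_weak_star_apply, of "ball 0 _"]
        by (auto simp flip: open_openin)
    qed
    ultimately have "openin ?T V" by simp
    moreover have "convex V"
    proof -
      have "V = dual_space \<inter> (\<Inter>i\<in>J. (\<lambda>\<phi>. blinfun_apply \<phi> i) -` ball 0 (e i))" by (auto simp: V_def)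
      moreover have "convex (\<dots>)"
        by (intro convex_Int[OF subspace_imp_convex[OF subspace_dual_space]] convex_INT
            convex_linear_vimage bounded_linear.linear[OF blinfun.bounded_linear_left] convex_ball)
      ultimately show ?thesis by simp
    qed
    moreover have "0 \<in> V"
      using e(1) subspace_0[OF subspace_dual_space] by (simp add: V_def blinfun.bilinear_simps)
    moreover have "V \<subseteq> U"
    proof
      fix \<phi> assume \<phi>: "\<phi> \<in> V"
      have "blinfun_apply \<phi> i \<in> X i" for i
      proof (cases "i \<in> J")
        case True
        then have "blinfun_apply \<phi> i \<in> ball 0 (e i)" using \<phi> by (simp add: V_def)
        then show ?thesis using e(2) by blast
      qed (simp add: J_def)
      then have "blinfun_apply \<phi> \<in> O'" using X(4) by (auto simp: PiE_iff)
      then show "\<phi> \<in> U" using \<phi> by (simp add: O'(2) V_def)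
    qed
    ultimately show ?thesis by blast
  qed
qed (rule subspace_dual_space, rule Hausdorff_weak_star_topology)

section \<open>Compactness\<close>

text \<open>Compactness is carried back along \<open>Blinfun\<close>, which inverts
  \<open>blinfun_apply\<close> on its range; continuity is therefore claimed only on the image of
  K.\<close>

lemma compactin_weak_star_topology:
  assumes K: "K \<subseteq> dual_space" and cpt: "compact (blinfun_apply ` K)"
  shows "compactin weak_star_topology K"
proof -
  have inv: "Blinfun (blinfun_apply \<phi>) = \<phi>" for \<phi> by (rule blinfun_apply_inverse)
  have "continuous_map (subtopology euclidean (blinfun_apply ` K)) weak_star_topology Blinfun"
  proof (rule continuous_map_into_weak_star)
    fix a
    show "continuous_map (subtopology euclidean (blinfun_apply ` K)) euclidean
        (\<lambda>f. blinfun_apply (Blinfun f) a)"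
    proof (rule continuous_map_eq)
      show "continuous_map (subtopology euclidean (blinfun_apply ` K)) euclidean (\<lambda>f. f a)"
        unfolding continuous_map_iff_continuous
        by (rule continuous_on_subset[OF continuous_on_product_coordinates]) simp
    qed (auto simp: inv)
  qed (use K in \<open>auto simp: inv\<close>)
  then have "compactin weak_star_topology (Blinfun ` blinfun_apply ` K)"
    using cpt by (intro image_compactin[of "subtopology euclidean (blinfun_apply ` K)"])
      (simp_all add: compactin_subtopology)
  then show ?thesis by (simp add: image_image inv)
qed

text \<open>The radii \<open>norm a\<close> come from \<open>norm_le\<close> with \<tau>(1) = 1.
  Conversely, a tracial state in this product of discs is bounded by definition of the discs, so the
  image is exactly a Tychonoff compact set cut by pointwise closed conditions.\<close>

lemma compactin_tracial_states:
  "compactin weak_star_topology (tracial_states :: ('a::unital_cstar_algebra \<Rightarrow>\<^sub>L complex) set)"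
proof (rule compactin_weak_star_topology)
  let ?D = "PiE UNIV (\<lambda>a :: 'a. cball (0 :: complex) (norm a))"
  have "blinfun_apply ` (tracial_states :: ('a \<Rightarrow>\<^sub>L complex) set) = ?D \<inter> Collect tracial_state"
  proof (intro equalityI subsetI)
    fix f assume "f \<in> blinfun_apply ` (tracial_states :: ('a \<Rightarrow>\<^sub>L complex) set)"
    then obtain \<tau> where \<tau>: "\<tau> \<in> tracial_states" "f = blinfun_apply \<tau>" by blast
    interpret normalized_trace f using \<tau> by (simp add: tracial_states_iff)
    show "f \<in> ?D \<inter> Collect tracial_state"
      using \<tau> norm_le[unfolded one] by (simp add: tracial_states_def PiE_iff)
  next
    fix f assume f: "f \<in> ?D \<inter> Collect tracial_state"
    then have "cmod (f a) \<le> 1 * norm a" for a by (simp add: PiE_iff)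
    then have "\<exists>C. \<forall>a. cmod (f a) \<le> C * norm a" by blast
    then have nf: "normalized_trace f"
      using f unfolding tracial_state_def mem_Collect_eq Int_iff
      by (intro normalized_trace.intro normalized_trace_axioms.intro tracial_functional.intro
        tracial_functional_axioms.intro positive_functional.intro clinear_functional.intro
        positive_functional_axioms.intro) blast+
    then interpret normalized_trace f .
    have "blinfun_apply (Blinfun f) = f" by (rule bounded_linear_Blinfun_apply[OF bounded_linear])
    then show "f \<in> blinfun_apply ` tracial_states"
      using nf by (metis imageI tracial_states_iff)
  qed
  moreover have "compact ?D"
    using compactin_PiE[of "\<lambda>_. euclidean" UNIV "\<lambda>a :: 'a. cball (0 :: complex) (norm a)"]
    by (simp add: euclidean_product_topology)
  moreover have "closed (Collect (tracial_state :: ('a \<Rightarrow> complex) \<Rightarrow> bool))"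
    unfolding tracial_state_def linear_scaleC_iff
    by (intro closed_Collect_conj closed_Collect_all closed_Collect_eq continuous_intros
        continuous_on_product_coordinates
        closed_vimage[OF closed_nonneg_Reals_complex, unfolded vimage_def])
  ultimately show "compact (blinfun_apply ` (tracial_states :: ('a \<Rightarrow>\<^sub>L complex) set))"
    by (simp add: compact_Int_closed)
qed (simp add: tracial_states_def)

theorem theorem1p1:
  shows "choquet_simplex weak_star_topology
           (tracial_states :: ('a::unital_cstar_algebra \<Rightarrow>\<^sub>L complex) set)"
  unfolding choquet_simplex_def
  by (intro conjI locally_convex_weak_star_topology compactin_tracial_states
      convex_tracial_states riesz_decomposition_tracial_states)

end
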